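(* Let $\omega=1$, $k\ge2$ an integer and $c_0\in\mathbb{R}$. Let $(\theta_0,\rho_0)$ be an admissible initial datum corresponding to a $k$-fold rotationally symmetric heterogeneous curve with $\kappa_0=\partial_s\theta_0\ge c_0$ on $[0,L]$, and let $(\theta,\rho)$ be the solution of the flow (F) with this initial datum. Then $\kappa=\partial_s\theta\ge c_0$ on $[0,\infty)\times[0,L]$. Similarly, if instead $\kappa_0\le c_0$ on $[0,L]$, then $\kappa\le c_0$ on $[0,\infty)\times[0,L]$.
   Context: Fixed parameters: $L>0$, $\nu\in\mathbb{R}$, $\mu>0$, $\omega\in\mathbb{Z}$, $c_0\in\mathbb{R}$, and $\beta\in C^\infty(\mathbb{R})$ with $\beta>0$. A function $\theta:[0,L]\to\mathbb{R}$ is the inclination angle of the arc-length parametrized planar curve $\gamma(s)=\gamma(0)+\int_0^s(\cos\theta,\sin\theta)\,\mathrm{d}r$, with curvature $\kappa=\partial_s\theta$; $\rho:[0,L]\to\mathbb{R}$ is a density. The flow (F) is the initial boundary value problem $$\partial_t\theta=\partial_s\big(\beta(\rho)(\partial_s\theta-c_0)\big)+\lambda_{\theta1}\sin\theta-\lambda_{\theta2}\cos\theta,\qquad \partial_t\rho=\mu\,\partial_s^2\rho-\tfrac12\beta'(\rho)(\partial_s\theta-c_0)^2-\lambda_\rho$$ on $(0,T)\times[0,L]$, with boundary conditions $\theta(\cdot,L)-\theta(\cdot,0)=2\pi\omega$, $\rho(\cdot,L)=\rho(\cdot,0)$, $\partial_s\theta(\cdot,L)=\partial_s\theta(\cdot,0)$,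 $\partial_s\rho(\cdot,L)=\partial_s\rho(\cdot,0)$, and initial condition $(\theta,\rho)(0,\cdot)=(\theta_0,\rho_0)$. The nonlocal multipliers are $$\begin{pmatrix}\lambda_{\theta1}\\ \lambda_{\theta2}\end{pmatrix}(t)=\Pi^{-1}(\theta)\int_0^L\begin{pmatrix}\cos\theta\\ \sin\theta\end{pmatrix}\partial_s\theta\,\beta(\rho)(\partial_s\theta-c_0)\,\mathrm{d}s,\quad \Pi(\theta)=\begin{pmatrix}\int_0^L\sin^2\theta\,\mathrm{d}s&-\int_0^L\cos\theta\sin\theta\,\mathrm{d}s\\-\int_0^L\cos\theta\sin\theta\,\mathrm{d}s&\int_0^L\cos^2\theta\,\mathrm{d}s\end{pmatrix},$$ $\lambda_\rho(t)=-\frac1{2L}\int_0^L\beta'(\rho)(\partial_s\theta-c_0)^2\,\mathrm{d}s$. An admissible initial datum is $(\theta_0,\rho_0)\in C^\infty([0,L])$ with $\int_0^L\rho_0\,\mathrm{d}s=\nu L$, $\int_0^L\sin\theta_0\,\mathrm{d}s=\int_0^L\cos\theta_0\,\mathrm{d}s=0$, $\theta_0(L)-\theta_0(0)=2\pi\omega$, $\rho_0(L)=\rho_0(0)$, and $\partial_s^j\theta_0(L)=\partial_s^j\theta_0(0)$, $\partial_s^j\rho_0(L)=\partial_s^j\rho_0(0)$ for $j=1,2$. By earlier work, for each admissible initial datum (F) has a unique global solution $(\theta,\rho)\in C^\infty((0,\infty)\times[0,L])\cap C^0([0,\infty);C^2([0,L]))$; for $t>0$ the functions $\partial_s\theta(t,\cdot)$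 and $\rho(t,\cdot)$ extend to smooth $L$-periodic functions on $\mathbb{R}$, and $\limsup_{t\to\infty}(\|\theta(t)\|_{W^{3,2}(0,L)}+\|\rho(t)\|_{W^{3,2}(0,L)})<\infty$. Rotational symmetry: let $\omega=1$, $\phi(s)=2\pi s/L$ and $k\in\mathbb{N}$, $k\ge2$. The heterogeneous curve described by $(\theta,\rho)\in C^\infty([0,L])$ is $k$-fold rotationally symmetric if the $L$-periodic extension of $(\theta-\phi,\rho)$ to $\mathbb{R}$ is $\frac Lk$-periodic. *)

theory Defs
  imports "HOL-Analysis.Analysis" "HOL-Library.Real_Mod"
begin

text \<open>Derivative relative to \<open>I\<close>. At the end points of a compact interval it is one-sided; at points
  of \<open>I\<close> only the values of \<open>f\<close> on \<open>I\<close> matter.\<close>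

definition deriv_within :: "real set \<Rightarrow> (real \<Rightarrow> real) \<Rightarrow> real \<Rightarrow> real" where
  "deriv_within I f = (\<lambda>s. vector_derivative f (at s within I))"

definition Ck_on :: "nat \<Rightarrow> real set \<Rightarrow> (real \<Rightarrow> real) \<Rightarrow> bool" where
  "Ck_on n I f \<longleftrightarrow>
     (\<forall>j<n. ((deriv_within I ^^ j) f) differentiable_on I) \<and>
     (\<forall>j\<le>n. continuous_on I ((deriv_within I ^^ j) f))"

definition smooth_on :: "real set \<Rightarrow> (real \<Rightarrow> real) \<Rightarrow> bool" where
  "smooth_on I f \<longleftrightarrow> (\<forall>n. Ck_on n I f)"

text \<open>A time-dependent function on \<open>[0,L]\<close> is a curried function \<open>f t s\<close>; its values for \<open>s\<close> outside
  \<open>[0,L]\<close> or \<open>t < 0\<close> are irrelevant.\<close>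

definition pt :: "(real \<Rightarrow> real \<Rightarrow> real) \<Rightarrow> real \<Rightarrow> real \<Rightarrow> real" where
  "pt f = (\<lambda>t s. vector_derivative (\<lambda>\<tau>. f \<tau> s) (at t))"

definition ps :: "real \<Rightarrow> (real \<Rightarrow> real \<Rightarrow> real) \<Rightarrow> real \<Rightarrow> real \<Rightarrow> real" where
  "ps L f = (\<lambda>t. deriv_within {0..L} (f t))"

text \<open>\<open>C\<^sup>n((0,\<infinity>) \<times> [0,L])\<close>: all mixed partial derivatives up to order \<open>n\<close>, taken in any order, exist
  and are continuous up to the lateral boundary.\<close>

primrec Ck_strip :: "real \<Rightarrow> nat \<Rightarrow> (real \<Rightarrow> real \<Rightarrow> real) \<Rightarrow> bool" where
  "Ck_strip L 0 f \<longleftrightarrow> continuous_on ({0<..} \<times> {0..L}) (\<lambda>(t, s). f t s)"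
| "Ck_strip L (Suc n) f \<longleftrightarrow>
     continuous_on ({0<..} \<times> {0..L}) (\<lambda>(t, s). f t s) \<and>
     (\<forall>t>0. \<forall>s\<in>{0..L}. (\<lambda>\<tau>. f \<tau> s) differentiable (at t)) \<and>
     (\<forall>t>0. f t differentiable_on {0..L}) \<and>
     Ck_strip L n (pt f) \<and> Ck_strip L n (ps L f)"

definition smooth_strip :: "real \<Rightarrow> (real \<Rightarrow> real \<Rightarrow> real) \<Rightarrow> bool" where
  "smooth_strip L f \<longleftrightarrow> (\<forall>n. Ck_strip L n f)"

text \<open>\<open>C\<^sup>0([0,\<infinity>); C\<^sup>n([0,L]))\<close>: convergence in the \<open>C\<^sup>n\<close> norm is uniform convergence of all
  derivatives up to order \<open>n\<close>.\<close>

definition C0_Ck :: "real \<Rightarrow> nat \<Rightarrow> (real \<Rightarrow> real \<Rightarrow> real) \<Rightarrow> bool" where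
  "C0_Ck L n f \<longleftrightarrow>
     (\<forall>t\<ge>0. Ck_on n {0..L} (f t)) \<and>
     (\<forall>t\<ge>0. \<forall>j\<le>n. uniform_limit {0..L} (\<lambda>\<tau>. (deriv_within {0..L} ^^ j) (f \<tau>))
                      ((deriv_within {0..L} ^^ j) (f t)) (at t within {0..}))"

definition Pi_mat :: "real \<Rightarrow> (real \<Rightarrow> real) \<Rightarrow> real^2^2" where
  "Pi_mat L \<theta> = vector
     [vector [integral {0..L} (\<lambda>s. (sin (\<theta> s))\<^sup>2), - integral {0..L} (\<lambda>s. cos (\<theta> s) * sin (\<theta> s))],
      vector [- integral {0..L} (\<lambda>s. cos (\<theta> s) * sin (\<theta> s)), integral {0..L} (\<lambda>s. (cos (\<theta> s))\<^sup>2)]]"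

text \<open>The multipliers as functionals of the profiles \<open>\<theta>(t,\<cdot>)\<close> and \<open>\<rho>(t,\<cdot>)\<close>.\<close>

definition lam_theta :: "real \<Rightarrow> (real \<Rightarrow> real) \<Rightarrow> real \<Rightarrow> (real \<Rightarrow> real) \<Rightarrow> (real \<Rightarrow> real) \<Rightarrow> real^2" where
  "lam_theta L \<beta> c0 \<theta> \<rho> =
     (let \<kappa> = deriv_within {0..L} \<theta> in
      matrix_inv (Pi_mat L \<theta>) *v vector
        [integral {0..L} (\<lambda>s. cos (\<theta> s) * \<kappa> s * \<beta> (\<rho> s) * (\<kappa> s - c0)),
         integral {0..L} (\<lambda>s. sin (\<theta> s) * \<kappa> s * \<beta> (\<rho> s) * (\<kappa> s - c0))])"

definition lam_rho :: "real \<Rightarrow> (real \<Rightarrow> real) \<Rightarrow> real \<Rightarrow> (real \<Rightarrow> real) \<Rightarrow> (real \<Rightarrow> real) \<Rightarrow> real" where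
  "lam_rho L \<beta> c0 \<theta> \<rho> =
     - (1 / (2 * L)) *
       integral {0..L} (\<lambda>s. deriv \<beta> (\<rho> s) * (deriv_within {0..L} \<theta> s - c0)\<^sup>2)"

definition admissible_datum ::
  "real \<Rightarrow> real \<Rightarrow> int \<Rightarrow> (real \<Rightarrow> real) \<Rightarrow> (real \<Rightarrow> real) \<Rightarrow> bool" where
  "admissible_datum L \<nu> \<omega> \<theta>\<^sub>0 \<rho>\<^sub>0 \<longleftrightarrow>
     smooth_on {0..L} \<theta>\<^sub>0 \<and> smooth_on {0..L} \<rho>\<^sub>0 \<and>
     integral {0..L} \<rho>\<^sub>0 = \<nu> * L \<and>
     integral {0..L} (\<lambda>s. sin (\<theta>\<^sub>0 s)) = 0 \<and>
     integral {0..L} (\<lambda>s. cos (\<theta>\<^sub>0 s)) = 0 \<and>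
     \<theta>\<^sub>0 L - \<theta>\<^sub>0 0 = 2 * pi * of_int \<omega> \<and>
     \<rho>\<^sub>0 L = \<rho>\<^sub>0 0 \<and>
     (\<forall>j\<in>{1, 2}. (deriv_within {0..L} ^^ j) \<theta>\<^sub>0 L = (deriv_within {0..L} ^^ j) \<theta>\<^sub>0 0 \<and>
                 (deriv_within {0..L} ^^ j) \<rho>\<^sub>0 L = (deriv_within {0..L} ^^ j) \<rho>\<^sub>0 0)"

text \<open>Global solutions in \<open>C\<^sup>\<infinity>((0,\<infinity>) \<times> [0,L]) \<inter> C\<^sup>0([0,\<infinity>); C\<^sup>2([0,L]))\<close>.\<close>

definition flow_solution ::
  "real \<Rightarrow> real \<Rightarrow> int \<Rightarrow> real \<Rightarrow> (real \<Rightarrow> real) \<Rightarrow> (real \<Rightarrow> real) \<Rightarrow> (real \<Rightarrow> real) \<Rightarrow>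
   (real \<Rightarrow> real \<Rightarrow> real) \<Rightarrow> (real \<Rightarrow> real \<Rightarrow> real) \<Rightarrow> bool" where
  "flow_solution L \<mu> \<omega> c0 \<beta> \<theta>\<^sub>0 \<rho>\<^sub>0 \<theta> \<rho> \<longleftrightarrow>
     smooth_strip L \<theta> \<and> smooth_strip L \<rho> \<and> C0_Ck L 2 \<theta> \<and> C0_Ck L 2 \<rho> \<and>
     (\<forall>t>0. \<forall>s\<in>{0..L}.
        pt \<theta> t s = ps L (\<lambda>t s. \<beta> (\<rho> t s) * (ps L \<theta> t s - c0)) t s
                   + lam_theta L \<beta> c0 (\<theta> t) (\<rho> t) $ 1 * sin (\<theta> t s)
                   - lam_theta L \<beta> c0 (\<theta> t) (\<rho> t) $ 2 * cos (\<theta> t s) \<and>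
        pt \<rho> t s = \<mu> * ps L (ps L \<rho>) t s
                   - 1 / 2 * deriv \<beta> (\<rho> t s) * (ps L \<theta> t s - c0)\<^sup>2
                   - lam_rho L \<beta> c0 (\<theta> t) (\<rho> t)) \<and>
     (\<forall>t>0. \<theta> t L - \<theta> t 0 = 2 * pi * of_int \<omega> \<and> \<rho> t L = \<rho> t 0 \<and>
            ps L \<theta> t L = ps L \<theta> t 0 \<and> ps L \<rho> t L = ps L \<rho> t 0) \<and>
     (\<forall>s\<in>{0..L}. \<theta> 0 s = \<theta>\<^sub>0 s \<and> \<rho> 0 s = \<rho>\<^sub>0 s)"

definition periodic_ext :: "real \<Rightarrow> (real \<Rightarrow> real) \<Rightarrow> real \<Rightarrow> real" where
  "periodic_ext L f = (\<lambda>s. f (s rmod L))"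

definition rot_symmetric :: "real \<Rightarrow> nat \<Rightarrow> (real \<Rightarrow> real) \<Rightarrow> (real \<Rightarrow> real) \<Rightarrow> bool" where
  "rot_symmetric L k \<theta> \<rho> \<longleftrightarrow>
     (\<forall>s. periodic_ext L (\<lambda>x. \<theta> x - 2 * pi * x / L) (s + L / real k) =
            periodic_ext L (\<lambda>x. \<theta> x - 2 * pi * x / L) s \<and>
          periodic_ext L \<rho> (s + L / real k) = periodic_ext L \<rho> s)"

end

theory Submission
  imports Defs
begin

text \<open>
The symmetry of the initial curve is inherited by the solution: if \<open>D\<close> and \<open>R\<close> are the differences
of \<open>\<theta>\<close> and \<open>\<rho>\<close> with their copies shifted by \<open>L/k\<close> (and rotated by \<open>2\<pi>/k\<close>), then the energy
\<open>\<integral> D\<^sup>2 + R\<^sup>2\<close> satisfies a Gronwall inequality. The multiplier \<open>\<lambda>\<^sub>\<rho>\<close> is the same constant for both copies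
and cancels. The multiplier term \<open>\<lambda>\<^sub>\<theta>\<^sub>1 sin - \<lambda>\<^sub>\<theta>\<^sub>2 cos\<close> contributes only terms of order \<open>\<integral> D\<^sup>2\<close>, because to
first order in \<open>D\<close> it is the increment of \<open>- \<lambda>\<^sub>\<theta>\<^sub>1 cos - \<lambda>\<^sub>\<theta>\<^sub>2 sin\<close>, whose integral vanishes along closed
curves; so no continuity of \<open>\<lambda>\<^sub>\<theta>\<close> in the solution is needed, only a bound. On a symmetric curve the vector
defining \<open>\<lambda>\<^sub>\<theta>\<close> is fixed by a nontrivial rotation, hence \<open>\<lambda>\<^sub>\<theta> = 0\<close>, and the classical minimum principle
applies to \<open>\<beta>(\<rho>) (\<kappa> - c\<^sub>0)\<close>.
\<close>

section \<open>Calculus on an interval and on a strip\<close>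

lemma deriv_within_eqI:
  assumes "a < b" "s \<in> {a..b}" "(f has_real_derivative D) (at s within {a..b})"
  shows "deriv_within {a..b} f s = D"
  using vector_derivative_within_closed_interval[OF assms(1,2), of f D] assms(3)
  by (simp add: deriv_within_def has_real_derivative_iff_has_vector_derivative)

lemma has_real_derivative_deriv_within:
  assumes "f differentiable_on S" "s \<in> S"
  shows "(f has_real_derivative deriv_within S f s) (at s within S)"
proof -
  have "f differentiable (at s within S)"
    using assms by (auto simp: differentiable_on_def)
  then show ?thesis
    unfolding deriv_within_def has_real_derivative_iff_has_vector_derivative
    by (metis vector_derivative_works)
qed

lemma deriv_within_cong:
  assumes "\<And>x. x \<in> S \<Longrightarrow> f x = g x" "s \<in> S"
  shows "deriv_within S f s = deriv_within S g s"
  unfolding deriv_within_def using assms by (intro vector_derivative_cong_eq) auto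

text \<open>Uniform convergence in time and continuity of one slice each contribute
  \<open>e / 2\<close>. This is how the norm convergence in \<open>C0_Ck\<close> becomes joint
  continuity up to \<open>t = 0\<close>.\<close>

lemma continuous_on_strip:
  fixes g :: "real \<Rightarrow> real \<Rightarrow> real"
  assumes slice: "\<And>t. t \<ge> 0 \<Longrightarrow> continuous_on S (g t)"
    and unif: "\<And>t. t \<ge> 0 \<Longrightarrow> uniform_limit S g (g t) (at t within {0..})"
  shows "continuous_on ({0..} \<times> S) (\<lambda>(t, s). g t s)"
  unfolding continuous_on_iff
proof (intro ballI allI impI)
  fix p :: "real \<times> real" and e :: real
  assume p: "p \<in> {0..} \<times> S" and e: "e > 0"
  obtain t s where ts: "p = (t, s)" "t \<ge> 0" "s \<in> S" using p by auto
  have "\<forall>\<^sub>F \<tau> in at t within {0..}. \<forall>x\<in>S. dist (g \<tau> x) (g t x) < e / 2"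
    using uniform_limitD[OF unif[OF ts(2)], of "e/2"] e by simp
  then obtain d1 where d1: "d1 > 0"
    "\<And>\<tau>. \<tau> \<ge> 0 \<Longrightarrow> \<tau> \<noteq> t \<Longrightarrow> dist \<tau> t < d1 \<Longrightarrow> \<forall>x\<in>S. dist (g \<tau> x) (g t x) < e / 2"
    unfolding eventually_at by auto
  obtain d2 where d2: "d2 > 0"
    "\<And>x. x \<in> S \<Longrightarrow> dist x s < d2 \<Longrightarrow> dist (g t x) (g t s) < e / 2"
    using slice[OF ts(2)] ts(3) e unfolding continuous_on_iff by (metis half_gt_zero)
  show "\<exists>d>0. \<forall>q\<in>{0..} \<times> S. dist q p < d \<longrightarrow>
      dist (case q of (t, s) \<Rightarrow> g t s) (case p of (t, s) \<Rightarrow> g t s) < e"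
  proof (intro exI[of _ "min d1 d2"] conjI ballI impI)
    show "min d1 d2 > 0" using d1 d2 by simp
    fix q assume q: "q \<in> {0..} \<times> S" and dq: "dist q p < min d1 d2"
    obtain \<tau> x where tx: "q = (\<tau>, x)" "\<tau> \<ge> 0" "x \<in> S" using q by auto
    have "dist \<tau> t < d1" "dist x s < d2"
      using dq dist_fst_le[of q p] dist_snd_le[of q p] by (auto simp: tx ts)
    then have "dist (g t x) (g t s) < e / 2" "dist (g \<tau> x) (g t x) < e / 2"
      using d1(2)[of \<tau>] d2(2)[of x] tx e by (auto, cases "\<tau> = t", auto)
    then have "dist (g \<tau> x) (g t s) < e"
      using dist_triangle_half_r[of "g t x" "g \<tau> x" e "g t s"] by (simp add: dist_commute)
    then show "dist (case q of (t, s) \<Rightarrow> g t s) (case p of (t, s) \<Rightarrow> g t s) < e"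
      by (simp add: tx ts)
  qed
qed

text \<open>Smoothness demands \<open>Ck_strip\<close> at every order, so losing one order to a
  derivative costs nothing and the rules can be iterated.\<close>

lemma smooth_stripD:
  assumes "smooth_strip L f"
  shows "smooth_strip L (pt f)" "smooth_strip L (ps L f)"
    "continuous_on ({0<..} \<times> {0..L}) (\<lambda>(t, s). f t s)"
    "\<And>t s. t > 0 \<Longrightarrow> s \<in> {0..L} \<Longrightarrow> ((\<lambda>\<tau>. f \<tau> s) has_real_derivative pt f t s) (at t)"
    "\<And>t s. t > 0 \<Longrightarrow> s \<in> {0..L} \<Longrightarrow> (f t has_real_derivative ps L f t s) (at s within {0..L})"
proof -
  have C: "Ck_strip L (Suc n) f" for n
    using assms unfolding smooth_strip_def by blast
  show "smooth_strip L (pt f)" "smooth_strip L (ps L f)"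
    unfolding smooth_strip_def using C by auto
  show "continuous_on ({0<..} \<times> {0..L}) (\<lambda>(t, s). f t s)"
    using C[of 0] by simp
  show "((\<lambda>\<tau>. f \<tau> s) has_real_derivative pt f t s) (at t)" if "t > 0" "s \<in> {0..L}" for t s
    using C[of 0] that unfolding pt_def has_real_derivative_iff_has_vector_derivative
    by (auto simp: vector_derivative_works)
  show "(f t has_real_derivative ps L f t s) (at s within {0..L})" if "t > 0" "s \<in> {0..L}" for t s
    using C[of 0] that unfolding ps_def by (auto intro: has_real_derivative_deriv_within)
qed

text \<open>Composed form for use as a continuity rule: it covers \<open>g t (s + m)\<close> for
  fixed \<open>t\<close> as well as functions of the pair \<open>(t, s)\<close>.\<close>

lemma strip_compose:
  fixes g :: "real \<Rightarrow> real \<Rightarrow> real"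
  assumes "continuous_on (A \<times> B) (\<lambda>(t, s). g t s)" "continuous_on S f" "continuous_on S h"
    "\<And>x. x \<in> S \<Longrightarrow> f x \<in> A" "\<And>x. x \<in> S \<Longrightarrow> h x \<in> B"
  shows "continuous_on S (\<lambda>x. g (f x) (h x))"
proof -
  have "continuous_on S (\<lambda>x. (f x, h x))" using assms by (intro continuous_intros)
  from continuous_on_compose2[OF assms(1) this] assms(4,5) show ?thesis by auto
qed

lemma C0_CkD:
  assumes "C0_Ck L n f" "j \<le> n"
  shows "continuous_on ({0..} \<times> {0..L}) (\<lambda>(t, s). (deriv_within {0..L} ^^ j) (f t) s)"
  using assms by (intro continuous_on_strip) (auto simp: C0_Ck_def Ck_on_def)

lemma Ck_on_UNIV_has_real_derivative:
  assumes "Ck_on n UNIV f" "j < n"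
  shows "((deriv_within UNIV ^^ j) f has_real_derivative (deriv_within UNIV ^^ Suc j) f x) (at x)"
  using has_real_derivative_deriv_within[of "(deriv_within UNIV ^^ j) f" UNIV x] assms
  by (auto simp: Ck_on_def)

section \<open>Shifted and parameter-dependent integrals\<close>

text \<open>The shift by \<open>h\<close> modulo \<open>L\<close>, realised without periodic
  extension: \<open>[0, L - h]\<close> moves by \<open>h\<close> onto \<open>[h, L]\<close>, and
  \<open>[L - h, L]\<close> moves by \<open>h - L\<close> onto \<open>[0, h]\<close>.\<close>

lemma integral_add_shifted:
  fixes f :: "real \<Rightarrow> real"
  assumes "0 < h" "h < L" "continuous_on {0..L} f"
  shows "integral {0..L - h} (\<lambda>s. f (s + h)) + integral {L - h..L} (\<lambda>s. f (s + (h - L))) =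
    integral {0..L} f"
proof -
  have "integral {0..L - h} (\<lambda>s. f (s + h)) = integral {h..L} f"
    using integral_shift_real_ivl[of h h L f] by simp
  moreover have "integral {L - h..L} (\<lambda>s. f (s + (h - L))) = integral {0..h} f"
    using integral_shift_real_ivl[of 0 "h - L" h f] by simp
  moreover have "integral {0..h} f + integral {h..L} f = integral {0..L} f"
    using Henstock_Kurzweil_Integration.integral_combine[where a=0 and c=h and b=L and f=f] assms integrable_continuous_interval[OF assms(3)] by simp
  ultimately show ?thesis by simp
qed

lemma has_real_derivative_integral_param:
  fixes g gt :: "real \<Rightarrow> real \<Rightarrow> real"
  assumes deriv: "\<And>t s. t > 0 \<Longrightarrow> s \<in> {a..b} \<Longrightarrow> ((\<lambda>\<tau>. g \<tau> s) has_real_derivative gt t s) (at t)"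
    and slice: "\<And>t. t > 0 \<Longrightarrow> continuous_on {a..b} (g t)"
    and cont: "continuous_on ({0<..} \<times> {a..b}) (\<lambda>(t, s). gt t s)" and "t > 0"
  shows "((\<lambda>\<tau>. integral {a..b} (g \<tau>)) has_real_derivative integral {a..b} (gt t)) (at t)"
proof -
  have "((\<lambda>\<tau>. integral (cbox a b) (g \<tau>)) has_real_derivative integral (cbox a b) (gt t)) (at t within {0<..})"
    using assms
    by (intro leibniz_rule_field_derivative)
       (auto intro: has_field_derivative_at_within[OF deriv] integrable_continuous_interval slice)
  then show ?thesis using \<open>t > 0\<close> by (simp add: at_within_open[of t "{0<..}"])
qed

lemma continuous_on_integral_param:
  fixes g :: "real \<Rightarrow> real \<Rightarrow> real"
  assumes "continuous_on (U \<times> {a..b}) (\<lambda>(t, s). g t s)"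
  shows "continuous_on U (\<lambda>t. integral {a..b} (g t))"
  using integral_continuous_on_param[of U a b g] assms by simp

lemma fundamental_theorem_of_calculus_real:
  fixes f f' :: "real \<Rightarrow> real"
  assumes "a \<le> b" "\<And>s. s \<in> {a..b} \<Longrightarrow> (f has_real_derivative f' s) (at s within {a..b})"
  shows "(f' has_integral (f b - f a)) {a..b}"
  using assms by (intro fundamental_theorem_of_calculus)
    (auto simp: has_real_derivative_iff_has_vector_derivative)

lemma strip_bounded:
  fixes g :: "real \<Rightarrow> real \<Rightarrow> real"
  assumes "continuous_on ({0..T} \<times> {0..L}) (\<lambda>(t, s). g t s)"
  obtains K where "\<And>t s. t \<in> {0..T} \<Longrightarrow> s \<in> {0..L} \<Longrightarrow> \<bar>g t s\<bar> \<le> K"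
proof -
  have "compact ((\<lambda>(t, s). g t s) ` ({0..T} \<times> {0..L}))"
    using assms by (intro compact_continuous_image compact_Times) auto
  then obtain K where "\<forall>y\<in>(\<lambda>(t, s). g t s) ` ({0..T} \<times> {0..L}). norm y \<le> K"
    using compact_imp_bounded bounded_iff by metis
  then show ?thesis by (intro that[of K]) force
qed

lemma has_integral_transform:
  fixes f g :: "real \<Rightarrow> real"
  assumes "(f has_integral i) S" "i = j" "\<And>s. s \<in> S \<Longrightarrow> f s = g s"
  shows "(g has_integral j) S"
  using has_integral_eq[of S f g i] assms by simp

text \<open>The translate maps \<open>[a, b]\<close> into \<open>[0, L]\<close>, so the chain rule
  also covers end points, where derivatives are one-sided.\<close>

lemma shifted_derivative:
  assumes "(f has_real_derivative D) (at (s + m) within {0..L})" "0 \<le> a + m" "b + m \<le> L"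
  shows "((\<lambda>s. f (s + m)) has_real_derivative D) (at s within {a..b})"
proof -
  have "(f has_real_derivative D) (at (s + m) within (\<lambda>s. s + m) ` {a..b})"
    by (rule DERIV_subset[OF assms(1)]) (use assms in auto)
  moreover have "((\<lambda>s. s + m) has_real_derivative 1) (at s within {a..b})"
    by (auto intro!: derivative_eq_intros)
  ultimately show ?thesis
    using DERIV_image_chain[of f D "\<lambda>s. s + m" s "{a..b}" 1] by (simp add: o_def)
qed

section \<open>Gronwall's inequality and a Taylor bound\<close>

text \<open>\<open>exp (- C * t) * E t\<close> is nonincreasing. The differential inequality is
  asked for only at positive times, where the flow equations hold; continuity carries the conclusion
  back to the initial value.\<close>

lemma gronwall_zero:
  fixes E E' :: "real \<Rightarrow> real"
  assumes cont: "continuous_on {0..T} E"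
    and deriv: "\<And>t. 0 < t \<Longrightarrow> t < T \<Longrightarrow> (E has_real_derivative E' t) (at t)"
    and bound: "\<And>t. 0 < t \<Longrightarrow> t < T \<Longrightarrow> E' t \<le> C * E t"
    and "E 0 = 0" "0 \<le> T"
  shows "E T \<le> 0"
proof -
  define G where "G = (\<lambda>t. - (exp (- C * t) * E t))"
  have "G 0 \<le> G T"
  proof (rule DERIV_nonneg_imp_increasing_open[OF \<open>0 \<le> T\<close>])
    fix t assume t: "0 < t" "t < T"
    have "(G has_real_derivative exp (- C * t) * (C * E t - E' t)) (at t)"
      unfolding G_def
      by (rule derivative_eq_intros deriv t refl | simp add: algebra_simps)+
    moreover have "exp (- C * t) * (C * E t - E' t) \<ge> 0"
      using bound[OF t] by simp
    ultimately show "\<exists>y. (G has_real_derivative y) (at t) \<and> 0 \<le> y" by blast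
    next
    show "continuous_on {0..T} G"
      unfolding G_def by (intro continuous_intros cont)
  qed
  then show ?thesis using assms by (simp add: G_def mult_le_0_iff)
qed

text \<open>The addition formulas give the remainder exactly as a combination of
  \<open>cos d - 1\<close> and \<open>sin d - d\<close>, each at most \<open>d\<^sup>2 / 2\<close>
  in absolute value. The bound holds for all \<open>d\<close>, so no smallness of an angle
  difference is ever required.\<close>

lemma cos_sin_taylor:
  fixes a b x d :: real
  shows "\<bar>(a * cos (x + d) + b * sin (x + d)) - (a * cos x + b * sin x) - (b * cos x - a * sin x) * d\<bar>
    \<le> (\<bar>a\<bar> + \<bar>b\<bar>) * d\<^sup>2"
proof -
  have c: "\<bar>cos d - 1\<bar> \<le> d\<^sup>2 / 2" for d :: real
  proof -
    have "\<bar>sin (d/2)\<bar> \<le> \<bar>d/2\<bar>" by (rule abs_sin_x_le_abs_x)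
    then have "(sin (d/2))\<^sup>2 \<le> (d/2)\<^sup>2" by (rule abs_le_square_iff[THEN iffD1])
    moreover have "cos d = 1 - 2 * (sin (d/2))\<^sup>2" using cos_double_sin[of "d/2"] by simp
    ultimately show ?thesis by (simp add: power_divide)
  qed
  have s: "\<bar>sin d - d\<bar> \<le> d\<^sup>2 / 2" for d :: real
  proof -
    show ?thesis
      using Maclaurin_sin_bound[of d 2] by (simp add: numeral_2_eq_2 sin_coeff_def power2_eq_square)
  qed
  have "(a * cos (x + d) + b * sin (x + d)) - (a * cos x + b * sin x) - (b * cos x - a * sin x) * d
    = (a * cos x + b * sin x) * (cos d - 1) + (b * cos x - a * sin x) * (sin d - d)"
    by (simp add: cos_add sin_add algebra_simps)
  also have "\<bar>\<dots>\<bar> \<le> \<bar>a * cos x + b * sin x\<bar> * \<bar>cos d - 1\<bar> + \<bar>b * cos x - a * sin x\<bar> * \<bar>sin d - d\<bar>"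
    by (metis abs_mult abs_triangle_ineq)
  also have "\<dots> \<le> (\<bar>a\<bar> + \<bar>b\<bar>) * (d\<^sup>2 / 2) + (\<bar>a\<bar> + \<bar>b\<bar>) * (d\<^sup>2 / 2)"
  proof (intro add_mono mult_mono c s)
    have *: "\<bar>a * u\<bar> \<le> \<bar>a\<bar>" if "\<bar>u\<bar> \<le> 1" for a u :: real
      using that mult_left_le[of "\<bar>u\<bar>" "\<bar>a\<bar>"] by (simp add: abs_mult)
    show "\<bar>a * cos x + b * sin x\<bar> \<le> \<bar>a\<bar> + \<bar>b\<bar>" "\<bar>b * cos x - a * sin x\<bar> \<le> \<bar>a\<bar> + \<bar>b\<bar>"
      using *[of "cos x" a] *[of "cos x" b] *[of "sin x" a] *[of "sin x" b]
      by (simp_all add: abs_le_iff)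
  qed auto
  finally show ?thesis by simp
qed

section \<open>Minimum principles on the periodic interval\<close>

text \<open>A minimum at an end point is treated like an interior one: periodicity makes both ends
  minima, which forces \<open>f'\<close> to vanish there. A negative second derivative would then
  make \<open>f\<close> drop below its minimum next to \<open>s0\<close>.\<close>

lemma second_deriv_nonneg_at_periodic_min:
  fixes f f' :: "real \<Rightarrow> real" and f2 :: real
  assumes "0 < L" and s0: "s0 \<in> {0..L}"
    and f': "\<And>s. s \<in> {0..L} \<Longrightarrow> (f has_real_derivative f' s) (at s within {0..L})"
    and f'': "(f' has_real_derivative f2) (at s0 within {0..L})"
    and per: "f 0 = f L" "f' 0 = f' L"
    and min: "\<And>s. s \<in> {0..L} \<Longrightarrow> f s0 \<le> f s"
  shows "f2 \<ge> 0"
proof -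
  \<comment> \<open>Stated for every minimiser \<open>s\<close>, so that it can be used at
    \<open>0\<close> when the minimum was found at \<open>L\<close>; likewise for
    \<open>left\<close>.\<close>
  have right: "f' s \<ge> 0" if "s \<in> {0..<L}" "f s = f s0" for s
  proof (rule ccontr)
    assume "\<not> f' s \<ge> 0"
    then have "f' s < 0" "s \<in> {0..L}" using that by auto
    then obtain d where "d > 0" "\<And>h. h > 0 \<Longrightarrow> s + h \<in> {0..L} \<Longrightarrow> h < d \<Longrightarrow> f (s + h) < f s"
      by (metis has_real_derivative_neg_dec_right[OF f'])
    note d = this
    define h where "h = min (d/2) (L - s)"
    have "h > 0" "h < d" "h \<le> L - s" using d(1) that by (auto simp: h_def)
    then show False using d(2)[of h] min[of "s + h"] that by auto
  qed
  have left: "f' s \<le> 0" if "s \<in> {0<..L}" "f s = f s0" for s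
  proof (rule ccontr)
    assume "\<not> f' s \<le> 0"
    then have "f' s > 0" "s \<in> {0..L}" using that by auto
    then obtain d where "d > 0" "\<And>h. h > 0 \<Longrightarrow> s - h \<in> {0..L} \<Longrightarrow> h < d \<Longrightarrow> f (s - h) < f s"
      by (metis has_real_derivative_pos_inc_left[OF f'])
    note d = this
    define h where "h = min (d/2) s"
    have "h > 0" "h < d" "h \<le> s" using d(1) that by (auto simp: h_def)
    then show False using d(2)[of h] min[of "s - h"] that by auto
  qed
  have zero: "f' s0 = 0"
    using left[of s0] right[of s0] left[of L] right[of 0] s0 per \<open>0 < L\<close>
    by (cases "s0 = 0"; cases "s0 = L") auto
  have mvt: "\<exists>z. a < z \<and> z < b \<and> f b - f a = (b - a) * f' z" if "0 \<le> a" "a < b" "b \<le> L" for a b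
  proof -
    have "(f has_derivative (*) (f' x)) (at x within {a..b})" if "a \<le> x" "x \<le> b" for x
      using f'[of x] that \<open>0 \<le> a\<close> \<open>b \<le> L\<close> unfolding has_field_derivative_def
      by (auto elim!: has_derivative_subset)
    from mvt_simple[OF \<open>a < b\<close> this] show ?thesis by (auto simp: mult.commute)
  qed
  show ?thesis
  proof (rule ccontr)
    assume neg: "\<not> f2 \<ge> 0"
    show False
    proof (cases "s0 < L")
      case True
      obtain d where d: "d > 0" "\<And>h. h > 0 \<Longrightarrow> s0 + h \<in> {0..L} \<Longrightarrow> h < d \<Longrightarrow> f' (s0 + h) < f' s0"
        using has_real_derivative_neg_dec_right[OF f''] neg by auto
      define e where "e = min (d/2) (L - s0)"
      have e: "e > 0" "e < d" "s0 + e \<le> L" using d True by (auto simp: e_def)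
      obtain z where z: "s0 < z" "z < s0 + e" "f (s0 + e) - f s0 = e * f' z"
        using mvt[of s0 "s0 + e"] e s0 by auto
      have "f' z < 0" using d(2)[of "z - s0"] z e s0 zero by auto
      then have "f (s0 + e) < f s0" using z(3) e by (smt (verit) mult_pos_neg)
      then show False using min[of "s0 + e"] e s0 by auto
    next
      case False
      then have "s0 = L" using s0 by auto
      obtain d where d: "d > 0" "\<And>h. h > 0 \<Longrightarrow> s0 - h \<in> {0..L} \<Longrightarrow> h < d \<Longrightarrow> f' (s0 - h) > f' s0"
        using has_real_derivative_neg_dec_left[OF f''] neg by auto
      define e where "e = min (d/2) L"
      have e: "e > 0" "e < d" "e \<le> L" using d \<open>0 < L\<close> by (auto simp: e_def)
      obtain z where z: "s0 - e < z" "z < s0" "f s0 - f (s0 - e) = e * f' z"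
        using mvt[of "s0 - e" s0] e \<open>s0 = L\<close> by auto
      have "f' z > 0" using d(2)[of "s0 - z"] z e \<open>s0 = L\<close> zero by auto
      then have "f (s0 - e) < f s0" using z(3) e by (smt (verit) mult_pos_pos)
      then show False using min[of "s0 - e"] e \<open>s0 = L\<close> by auto
    qed
  qed
qed

text \<open>The weight \<open>exp (- (C + 1) * t)\<close> lowers the potential to at most -1. At a
  negative minimum of the weighted function the time derivative is then strictly positive, so
  smaller values occur just before. The minimum is not at time 0 by \<open>init\<close>.\<close>

lemma parabolic_minimum_principle:
  fixes G Gt Gs Gss a c :: "real \<Rightarrow> real \<Rightarrow> real"
  assumes "0 < L" "0 \<le> T"
    and cont: "continuous_on ({0..T} \<times> {0..L}) (\<lambda>(t, s). G t s)"
    and dt: "\<And>t s. 0 < t \<Longrightarrow> t \<le> T \<Longrightarrow> s \<in> {0..L} \<Longrightarrow> ((\<lambda>\<tau>. G \<tau> s) has_real_derivative Gt t s) (at t)"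
    and ds: "\<And>t s. 0 < t \<Longrightarrow> t \<le> T \<Longrightarrow> s \<in> {0..L} \<Longrightarrow>
      (G t has_real_derivative Gs t s) (at s within {0..L})"
    and dss: "\<And>t s. 0 < t \<Longrightarrow> t \<le> T \<Longrightarrow> s \<in> {0..L} \<Longrightarrow>
      (Gs t has_real_derivative Gss t s) (at s within {0..L})"
    and per: "\<And>t. 0 < t \<Longrightarrow> t \<le> T \<Longrightarrow> G t 0 = G t L" "\<And>t. 0 < t \<Longrightarrow> t \<le> T \<Longrightarrow> Gs t 0 = Gs t L"
    and pde: "\<And>t s. 0 < t \<Longrightarrow> t \<le> T \<Longrightarrow> s \<in> {0..L} \<Longrightarrow> Gt t s = a t s * Gss t s + c t s * G t s"
    and a: "\<And>t s. 0 < t \<Longrightarrow> t \<le> T \<Longrightarrow> s \<in> {0..L} \<Longrightarrow> 0 \<le> a t s"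
    and c: "\<And>t s. 0 < t \<Longrightarrow> t \<le> T \<Longrightarrow> s \<in> {0..L} \<Longrightarrow> c t s \<le> C"
    and init: "\<And>s. s \<in> {0..L} \<Longrightarrow> 0 \<le> G 0 s"
    and s: "s \<in> {0..L}"
  shows "0 \<le> G T s"
proof (rule ccontr)
  assume neg: "\<not> 0 \<le> G T s"
  define W where "W = (\<lambda>(t, s). exp (- (C + 1) * t) * G t s)"
  have "continuous_on ({0..T} \<times> {0..L}) W"
    using cont unfolding W_def case_prod_unfold by (intro continuous_intros) auto
  then obtain p where p: "p \<in> {0..T} \<times> {0..L}" "\<And>q. q \<in> {0..T} \<times> {0..L} \<Longrightarrow> W p \<le> W q"
    using continuous_attains_inf[of "{0..T} \<times> {0..L}" W] s \<open>0 \<le> T\<close>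
    by (auto simp: compact_Times)
  obtain t0 s0 where p_eq: "p = (t0, s0)" by force
  have ts0: "t0 \<in> {0..T}" "s0 \<in> {0..L}" using p p_eq by auto
  have "W p \<le> W (T, s)" using p(2) s \<open>0 \<le> T\<close> by auto
  also have "W (T, s) < 0" using neg by (simp add: W_def mult_less_0_iff)
  finally have Gneg: "G t0 s0 < 0" by (simp add: W_def p_eq mult_less_0_iff)
  then have "t0 > 0" using init[OF ts0(2)] ts0 by (cases "t0 = 0") auto
  then have t0: "0 < t0" "t0 \<le> T" using ts0 by auto
  have "G t0 s0 \<le> G t0 x" if "x \<in> {0..L}" for x
    using p(2)[of "(t0, x)"] that ts0 by (simp add: W_def p_eq)
  then have Gss: "Gss t0 s0 \<ge> 0"
    using ts0 t0 by (intro second_deriv_nonneg_at_periodic_min[OF \<open>0 < L\<close> _ ds dss per]) auto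
  have "c t0 s0 * G t0 s0 \<ge> C * G t0 s0"
    using Gneg c[OF t0 ts0(2)] by (intro mult_right_mono_neg) auto
  moreover have "a t0 s0 * Gss t0 s0 \<ge> 0"
    using a[OF t0 ts0(2)] Gss by simp
  \<comment> \<open>The left side is at least \<open>C * G t0 s0 - (C + 1) * G t0 s0\<close>, that
    is \<open>- G t0 s0\<close>.\<close>
  ultimately have "Gt t0 s0 - (C + 1) * G t0 s0 > 0"
    unfolding pde[OF t0 ts0(2)] distrib_right mult_1 using Gneg by linarith
  then have pos: "exp (- (C + 1) * t0) * (Gt t0 s0 - (C + 1) * G t0 s0) > 0" by simp
  have "((\<lambda>t. W (t, s0)) has_real_derivative exp (- (C + 1) * t0) * (Gt t0 s0 - (C + 1) * G t0 s0)) (at t0)"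
    unfolding W_def prod.case
    by (rule derivative_eq_intros dt t0 ts0 refl | simp add: algebra_simps)+
  then obtain d where d: "d > 0" "\<And>h. h > 0 \<Longrightarrow> h < d \<Longrightarrow> W (t0 - h, s0) < W (t0, s0)"
    using DERIV_pos_inc_left[OF _ pos] by blast
  define h where "h = min (d/2) t0"
  have "h > 0" "h < d" "h \<le> t0" using d t0 by (auto simp: h_def)
  then show False
    using d(2)[of h] p(2)[of "(t0 - h, s0)"] ts0 p_eq by auto
qed

text \<open>The diffusion absorbs every product of \<open>\<bar>u - w\<bar>\<close> with \<open>\<bar>r\<bar>\<close>; here \<open>u, w\<close> stand for \<open>\<kappa> - c0\<close> at
  two points, \<open>r\<close> for the difference of \<open>\<rho>\<close>, and \<open>p, q\<close> (\<open>p', q'\<close>) for the values of \<open>\<beta>\<close> (of its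
  derivative) there.\<close>

lemma diffusion_absorbs:
  fixes u w r p q p' q' b B1 B2 K :: real
  assumes "\<bar>u\<bar> \<le> K" "\<bar>w\<bar> \<le> K" "0 < b" "b \<le> p" "\<bar>p - q\<bar> \<le> B1 * \<bar>r\<bar>" "\<bar>q'\<bar> \<le> B1"
    "\<bar>p' - q'\<bar> \<le> B2 * \<bar>r\<bar>"
  shows "- ((u - w) * (p * u - q * w)) - 1 / 2 * r * (p' * u\<^sup>2 - q' * w\<^sup>2)
    \<le> ((B1 * K)\<^sup>2 / b + B2 * K\<^sup>2) * r\<^sup>2"
proof -
  define d where "d = \<bar>u - w\<bar>"
  have K: "0 \<le> K" and B1: "0 \<le> B1" using assms by linarith+
  have d: "0 \<le> d" "d\<^sup>2 = (u - w)\<^sup>2" by (simp_all add: d_def)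
  \<comment> \<open>Writing \<open>p * u - q * w\<close> as \<open>p * (u - w) + (p - q) * w\<close>
    separates the dissipation from a term controlled by \<open>r\<close>.\<close>
  have "- ((u - w) * (p * u - q * w)) = - p * d\<^sup>2 - (u - w) * (p - q) * w"
    unfolding d(2) by (simp add: algebra_simps power2_eq_square)
  moreover have "b * d\<^sup>2 \<le> p * d\<^sup>2" using assms by (intro mult_right_mono) auto
  moreover have "\<bar>(u - w) * (p - q) * w\<bar> \<le> d * (B1 * \<bar>r\<bar>) * K"
    unfolding abs_mult d_def using assms B1 by (intro mult_mono) auto
  ultimately have 1: "- ((u - w) * (p * u - q * w)) \<le> - (b * d\<^sup>2) + d * (B1 * \<bar>r\<bar>) * K"
    by linarith
  have "r * (p' * u\<^sup>2 - q' * w\<^sup>2) = r * (p' - q') * u\<^sup>2 + r * q' * ((u - w) * (u + w))"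
    by (simp add: algebra_simps power2_eq_square)
  moreover have "\<bar>r * (p' - q') * u\<^sup>2\<bar> \<le> \<bar>r\<bar> * (B2 * \<bar>r\<bar>) * K\<^sup>2"
    unfolding abs_mult using assms K abs_le_square_iff[of u K]
    by (intro mult_mono) (auto intro: order_trans[OF abs_ge_zero])
  moreover have "\<bar>r * q' * ((u - w) * (u + w))\<bar> \<le> \<bar>r\<bar> * B1 * (d * (2 * K))"
    unfolding abs_mult d_def using assms B1 by (intro mult_mono) auto
  ultimately have 2: "- 1 / 2 * r * (p' * u\<^sup>2 - q' * w\<^sup>2) \<le>
      1 / 2 * (\<bar>r\<bar> * (B2 * \<bar>r\<bar>) * K\<^sup>2) + 1 / 2 * (\<bar>r\<bar> * B1 * (d * (2 * K)))"
    by linarith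
  \<comment> \<open>The cross terms of estimates 1 and 2 add up to
    \<open>2 * d * (B1 * K * \<bar>r\<bar>)\<close>; completing the square absorbs them into
    \<open>b * d\<^sup>2\<close>.\<close>
  have "0 \<le> b * (d - B1 * K * \<bar>r\<bar> / b)\<^sup>2" using assms by simp
  also have "\<dots> = b * d\<^sup>2 - 2 * d * (B1 * K * \<bar>r\<bar>) + (B1 * K)\<^sup>2 / b * r\<^sup>2"
    using \<open>0 < b\<close> by (simp add: power2_diff power_mult_distrib power_divide field_simps)
       (simp add: power2_eq_square algebra_simps)
  finally have 3: "2 * d * (B1 * K * \<bar>r\<bar>) - b * d\<^sup>2 \<le> (B1 * K)\<^sup>2 / b * r\<^sup>2" by linarith
  have 4: "\<bar>r\<bar> * (B2 * \<bar>r\<bar>) * K\<^sup>2 = B2 * K\<^sup>2 * r\<^sup>2"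
    by (simp add: power2_eq_square algebra_simps flip: abs_mult)
  \<comment> \<open>The sign comes from the bound on \<open>p' - q'\<close>; it allows the factor
    1/2 in estimate 2 to be dropped.\<close>
  have "0 \<le> \<bar>r\<bar> * (B2 * \<bar>r\<bar>) * K\<^sup>2"
    using order_trans[OF abs_ge_zero assms(7)]
    by (intro mult_nonneg_nonneg[OF mult_nonneg_nonneg]) (auto simp del: zero_le_mult_iff)
  then show ?thesis using 1 2 3 unfolding 4 distrib_right by (simp add: algebra_simps)
qed

section \<open>Solutions of the flow with rotation index one\<close>

locale closed_flow =
  fixes L \<nu> \<mu> c0 :: real
    and \<beta> \<theta>\<^sub>0 \<rho>\<^sub>0 :: "real \<Rightarrow> real"
    and \<theta> \<rho> :: "real \<Rightarrow> real \<Rightarrow> real"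
  assumes L_pos: "L > 0" and mu_pos: "\<mu> > 0"
    and beta_smooth: "smooth_on UNIV \<beta>" and beta_pos: "\<And>x. \<beta> x > 0"
    and datum: "admissible_datum L \<nu> 1 \<theta>\<^sub>0 \<rho>\<^sub>0"
    and flow: "flow_solution L \<mu> 1 c0 \<beta> \<theta>\<^sub>0 \<rho>\<^sub>0 \<theta> \<rho>"
begin

abbreviation \<kappa> :: "real \<Rightarrow> real \<Rightarrow> real" where "\<kappa> \<equiv> ps L \<theta>"

text \<open>The flux in the equation for \<theta>. As \<beta> is positive, it has the sign of
  \<open>\<kappa> - c0\<close>, so both curvature bounds are sign conditions on
  \<open>F\<close>.\<close>

definition F :: "real \<Rightarrow> real \<Rightarrow> real" where
  "F = (\<lambda>t s. \<beta> (\<rho> t s) * (\<kappa> t s - c0))"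

abbreviation Fs :: "real \<Rightarrow> real \<Rightarrow> real" where "Fs \<equiv> ps L F"

definition lam1 :: "real \<Rightarrow> real" where "lam1 t = lam_theta L \<beta> c0 (\<theta> t) (\<rho> t) $ 1"
definition lam2 :: "real \<Rightarrow> real" where "lam2 t = lam_theta L \<beta> c0 (\<theta> t) (\<rho> t) $ 2"
definition lamr :: "real \<Rightarrow> real" where "lamr t = lam_rho L \<beta> c0 (\<theta> t) (\<rho> t)"

lemma beta_deriv:
  "(\<beta> has_real_derivative deriv \<beta> x) (at x)"
  "(deriv \<beta> has_real_derivative deriv (deriv \<beta>) x) (at x)"
  "continuous_on UNIV (deriv (deriv \<beta>))"
proof -
  have C: "Ck_on 2 UNIV \<beta>" using beta_smooth by (simp add: smooth_on_def)
  have 0: "(\<beta> has_real_derivative deriv_within UNIV \<beta> x) (at x)" for x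
    using Ck_on_UNIV_has_real_derivative[OF C, of 0] by simp
  then have d: "deriv \<beta> = deriv_within UNIV \<beta>"
    by (intro ext DERIV_imp_deriv)
  have 1: "(deriv \<beta> has_real_derivative deriv_within UNIV (deriv \<beta>) x) (at x)" for x
    using Ck_on_UNIV_has_real_derivative[OF C, of 1] by (simp add: d)
  then have dd: "deriv (deriv \<beta>) = deriv_within UNIV (deriv \<beta>)"
    by (intro ext DERIV_imp_deriv)
  show "(\<beta> has_real_derivative deriv \<beta> x) (at x)" using 0 by (simp add: d)
  show "(deriv \<beta> has_real_derivative deriv (deriv \<beta>) x) (at x)" using 1 by (simp add: dd)
  have "continuous_on UNIV ((deriv_within UNIV ^^ 2) \<beta>)"
    using C by (simp add: Ck_on_def)
  then show "continuous_on UNIV (deriv (deriv \<beta>))"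
    by (simp add: numeral_2_eq_2 dd d[symmetric])
qed

lemma cont_beta [continuous_intros]:
  assumes "continuous_on S f"
  shows "continuous_on S (\<lambda>x. \<beta> (f x))" "continuous_on S (\<lambda>x. deriv \<beta> (f x))"
proof -
  have "continuous_on UNIV \<beta>" "continuous_on UNIV (deriv \<beta>)"
    using beta_deriv(1,2) by (auto intro: DERIV_continuous_on)
  with assms show "continuous_on S (\<lambda>x. \<beta> (f x))" "continuous_on S (\<lambda>x. deriv \<beta> (f x))"
    by (auto intro: continuous_on_compose2)
qed

lemma smooth: "smooth_strip L \<theta>" "smooth_strip L \<rho>"
  and C0: "C0_Ck L 2 \<theta>" "C0_Ck L 2 \<rho>"
  using flow by (auto simp: flow_solution_def)

lemma pde_theta: "t > 0 \<Longrightarrow> s \<in> {0..L} \<Longrightarrow>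
    pt \<theta> t s = Fs t s + lam1 t * sin (\<theta> t s) - lam2 t * cos (\<theta> t s)"
  and pde_rho: "t > 0 \<Longrightarrow> s \<in> {0..L} \<Longrightarrow>
    pt \<rho> t s = \<mu> * ps L (ps L \<rho>) t s - 1 / 2 * deriv \<beta> (\<rho> t s) * (\<kappa> t s - c0)\<^sup>2 - lamr t"
  using flow by (simp_all add: flow_solution_def F_def lam1_def lam2_def lamr_def)

lemma init: "s \<in> {0..L} \<Longrightarrow> \<theta> 0 s = \<theta>\<^sub>0 s" "s \<in> {0..L} \<Longrightarrow> \<rho> 0 s = \<rho>\<^sub>0 s"
  using flow by (auto simp: flow_solution_def)

lemma kappa_0: "s \<in> {0..L} \<Longrightarrow> \<kappa> 0 s = deriv_within {0..L} \<theta>\<^sub>0 s"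
  unfolding ps_def by (rule deriv_within_cong) (auto simp: init)

lemma theta_periodic: "t \<ge> 0 \<Longrightarrow> \<theta> t L = \<theta> t 0 + 2 * pi"
  using flow datum init[of 0] init[of L] L_pos
  by (cases "t = 0") (auto simp: flow_solution_def admissible_datum_def algebra_simps)

lemma rho_periodic: "t > 0 \<Longrightarrow> \<rho> t L = \<rho> t 0"
  and kappa_periodic: "t > 0 \<Longrightarrow> \<kappa> t L = \<kappa> t 0"
  and rhos_periodic: "t > 0 \<Longrightarrow> ps L \<rho> t L = ps L \<rho> t 0"
  using flow by (auto simp: flow_solution_def)

lemma F_periodic: "t > 0 \<Longrightarrow> F t L = F t 0"
  by (simp add: F_def rho_periodic kappa_periodic)

text \<open>These are the derivatives controlled down to \<open>t = 0\<close> by the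
  \<open>C0_Ck\<close> regularity. The second derivative of \<rho> enters the potential in the
  minimum principle.\<close>

lemma cont_closed_strip:
  "continuous_on ({0..} \<times> {0..L}) (\<lambda>(t, s). \<theta> t s)"
  "continuous_on ({0..} \<times> {0..L}) (\<lambda>(t, s). \<kappa> t s)"
  "continuous_on ({0..} \<times> {0..L}) (\<lambda>(t, s). \<rho> t s)"
  "continuous_on ({0..} \<times> {0..L}) (\<lambda>(t, s). ps L (ps L \<rho>) t s)"
  using C0_CkD[OF C0(1), of 0] C0_CkD[OF C0(1), of 1] C0_CkD[OF C0(2), of 0] C0_CkD[OF C0(2), of 2]
  by (simp_all add: ps_def numeral_2_eq_2)

lemmas cont [continuous_intros] = cont_closed_strip[THEN strip_compose]

lemma cont_F [continuous_intros]:
  assumes "continuous_on S f" "continuous_on S h" "\<And>x. x \<in> S \<Longrightarrow> f x \<in> {0..}"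
    "\<And>x. x \<in> S \<Longrightarrow> h x \<in> {0..L}"
  shows "continuous_on S (\<lambda>x. F (f x) (h x))"
  unfolding F_def by (intro continuous_intros assms)

text \<open>Time derivatives, in contrast, are known to be continuous only for
  \<open>t > 0\<close>.\<close>

lemmas cont_open_strip [continuous_intros] =
  smooth_stripD(3)[OF smooth_stripD(1)[OF smooth(1)], THEN strip_compose]
  smooth_stripD(3)[OF smooth_stripD(1)[OF smooth(2)], THEN strip_compose]
  smooth_stripD(3)[OF smooth_stripD(1)[OF smooth_stripD(2)[OF smooth(1)]], THEN strip_compose]

lemmas dt_theta = smooth_stripD(4)[OF smooth(1)]
lemmas ds_theta = smooth_stripD(5)[OF smooth(1)]
lemmas dt_rho = smooth_stripD(4)[OF smooth(2)]
lemmas ds_rho = smooth_stripD(5)[OF smooth(2)]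
lemmas dt_kappa = smooth_stripD(4)[OF smooth_stripD(2)[OF smooth(1)]]
lemmas ds_kappa = smooth_stripD(5)[OF smooth_stripD(2)[OF smooth(1)]]
lemmas dss_rho = smooth_stripD(5)[OF smooth_stripD(2)[OF smooth(2)]]

lemma dt_F:
  assumes "t > 0" "s \<in> {0..L}"
  shows "((\<lambda>\<tau>. F \<tau> s) has_real_derivative
    deriv \<beta> (\<rho> t s) * pt \<rho> t s * (\<kappa> t s - c0) + \<beta> (\<rho> t s) * pt \<kappa> t s) (at t)"
  unfolding F_def
  using DERIV_chain2[OF beta_deriv(1) dt_rho[OF assms]]
  by (auto intro!: derivative_eq_intros dt_kappa assms)

lemma ds_F:
  assumes "t > 0" "s \<in> {0..L}"
  shows "(F t has_real_derivative Fs t s) (at s within {0..L})"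
proof -
  have "(F t has_real_derivative
      deriv \<beta> (\<rho> t s) * ps L \<rho> t s * (\<kappa> t s - c0) + \<beta> (\<rho> t s) * ps L \<kappa> t s) (at s within {0..L})"
    unfolding F_def
    using DERIV_chain2[OF beta_deriv(1) ds_rho[OF assms]]
    by (auto intro!: derivative_eq_intros ds_kappa assms)
  with deriv_within_eqI[OF L_pos assms(2) this] show ?thesis by (simp add: ps_def)
qed

text \<open>Differentiating \<open>\<theta> t s - \<theta> t 0 = \<integral> \<kappa>\<close> in time gives the symmetry of the mixed
  derivatives up to the lateral boundary.\<close>

lemma mixed_derivative:
  assumes "t > 0" "s \<in> {0..L}"
  shows "(pt \<theta> t has_real_derivative pt \<kappa> t s) (at s within {0..L})"
proof -
  have eq: "pt \<theta> t x - pt \<theta> t 0 = integral {0..x} (pt \<kappa> t)" if x: "x \<in> {0..L}" for x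
  \<comment> \<open>Both sides are the derivative of
    \<open>\<theta> \<tau> x - \<theta> \<tau> 0\<close> at time \<open>t\<close>: once under the
    integral sign, once directly.\<close>
  proof (rule DERIV_unique)
    have "continuous_on ({0<..} \<times> {0..x}) (\<lambda>(\<tau>, y). pt \<kappa> \<tau> y)"
      unfolding case_prod_unfold using x by (intro continuous_intros) auto
    then have "((\<lambda>\<tau>. integral {0..x} (\<kappa> \<tau>)) has_real_derivative integral {0..x} (pt \<kappa> t)) (at t)"
      using x assms(1)
      by (intro has_real_derivative_integral_param dt_kappa continuous_intros) auto
    moreover have "integral {0..x} (\<kappa> \<tau>) = \<theta> \<tau> x - \<theta> \<tau> 0" if "\<tau> > 0" for \<tau>
      using x that
      by (intro integral_unique fundamental_theorem_of_calculus_real DERIV_subset[OF ds_theta]) auto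
    ultimately show "((\<lambda>\<tau>. \<theta> \<tau> x - \<theta> \<tau> 0) has_real_derivative integral {0..x} (pt \<kappa> t)) (at t)"
      using assms(1) by (elim has_field_derivative_transform_within_open[where S = "{0<..}"]) auto
    show "((\<lambda>\<tau>. \<theta> \<tau> x - \<theta> \<tau> 0) has_real_derivative pt \<theta> t x - pt \<theta> t 0) (at t)"
      using x assms by (intro derivative_intros dt_theta) auto
  qed
  have "((\<lambda>x. pt \<theta> t 0 + integral {0..x} (pt \<kappa> t)) has_real_derivative 0 + pt \<kappa> t s) (at s within {0..L})"
    using assms by (intro derivative_intros integral_has_real_derivative continuous_intros) auto
  moreover have "pt \<theta> t 0 + integral {0..x} (pt \<kappa> t) = pt \<theta> t x" if "x \<in> {0..L}" for x
    using eq[OF that] by simp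
  ultimately show ?thesis
    using assms(2) by (auto elim!: has_field_derivative_transform_within[where d = 1])
qed

subsection \<open>The multipliers and closedness\<close>

text \<open>By the intermediate value theorem the angle sweeps an interval of length 2 pi. With
  \<open>x = 0\<close> and \<open>x = pi / 2\<close> this yields points where the tangent is
  horizontal and vertical.\<close>

lemma sin_shifted_zero:
  assumes "t \<ge> 0"
  shows "\<exists>s\<in>{0..L}. sin (\<theta> t s + x) = 0"
proof -
  \<comment> \<open>The first multiple of pi at or above \<open>\<theta> t 0 + x\<close>.\<close>
  obtain n :: int where "(\<theta> t 0 + x) / pi \<le> of_int n" "of_int n \<le> (\<theta> t 0 + x) / pi + 1"
    using le_of_int_ceiling of_int_ceiling_le_add_one by blast
  moreover define y where "y = pi * of_int n"
  ultimately have "\<theta> t 0 + x \<le> y" "y \<le> \<theta> t 0 + x + pi"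
    by (simp_all add: field_simps)
  then have "\<theta> t 0 \<le> y - x" "y - x \<le> \<theta> t L"
    using theta_periodic[OF assms] pi_gt_zero by linarith+
  moreover have "continuous_on {0..L} (\<theta> t)"
    using assms by (intro continuous_intros) auto
  ultimately obtain s where "0 \<le> s" "s \<le> L" "\<theta> t s = y - x"
    using IVT'[of "\<theta> t" 0 "y - x" L] L_pos by auto
  then show ?thesis by (intro bexI[of _ s]) (auto simp: y_def)
qed

text \<open>Up to sign, \<open>ss\<close>, \<open>cc\<close> and \<open>cs\<close> are the entries
  of \<open>Pi_mat\<close>; \<open>v1\<close> and \<open>v2\<close> form the right-hand side of the
  system for the multipliers.\<close>

definition ss :: "real \<Rightarrow> real" where "ss t = integral {0..L} (\<lambda>s. (sin (\<theta> t s))\<^sup>2)"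
definition cc :: "real \<Rightarrow> real" where "cc t = integral {0..L} (\<lambda>s. (cos (\<theta> t s))\<^sup>2)"
definition cs :: "real \<Rightarrow> real" where "cs t = integral {0..L} (\<lambda>s. cos (\<theta> t s) * sin (\<theta> t s))"
definition v1 :: "real \<Rightarrow> real" where "v1 t = integral {0..L} (\<lambda>s. cos (\<theta> t s) * \<kappa> t s * F t s)"
definition v2 :: "real \<Rightarrow> real" where "v2 t = integral {0..L} (\<lambda>s. sin (\<theta> t s) * \<kappa> t s * F t s)"

lemma moments:
  assumes "t \<ge> 0"
  shows "((\<lambda>s. (sin (\<theta> t s))\<^sup>2) has_integral ss t) {0..L}"
    "((\<lambda>s. (cos (\<theta> t s))\<^sup>2) has_integral cc t) {0..L}"
    "((\<lambda>s. cos (\<theta> t s) * sin (\<theta> t s)) has_integral cs t) {0..L}"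
    "((\<lambda>s. cos (\<theta> t s) * \<kappa> t s * F t s) has_integral v1 t) {0..L}"
    "((\<lambda>s. sin (\<theta> t s) * \<kappa> t s * F t s) has_integral v2 t) {0..L}"
  unfolding ss_def cc_def cs_def v1_def v2_def using assms
  by (auto intro!: integrable_integral integrable_continuous_interval continuous_intros)

text \<open>Equality case of Cauchy-Schwarz: the integral of \<open>?f\<close> is
  \<open>cc t\<close> times the determinant. If it vanishes, sine and cosine of \<theta> are
  linearly dependent on \<open>[0, L]\<close>, which the zeros from \<open>sin_shifted_zero\<close>
  exclude.\<close>

lemma det_nonzero:
  assumes "t \<ge> 0"
  shows "ss t * cc t - (cs t)\<^sup>2 \<noteq> 0"
proof
  assume det: "ss t * cc t - (cs t)\<^sup>2 = 0"
  let ?f = "\<lambda>s. (cc t * sin (\<theta> t s) - cs t * cos (\<theta> t s))\<^sup>2"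
  have "((\<lambda>s. (cc t)\<^sup>2 * (sin (\<theta> t s))\<^sup>2 - (2 * cc t * cs t) * (cos (\<theta> t s) * sin (\<theta> t s)) +
      (cs t)\<^sup>2 * (cos (\<theta> t s))\<^sup>2) has_integral
      (cc t)\<^sup>2 * ss t - (2 * cc t * cs t) * cs t + (cs t)\<^sup>2 * cc t) {0..L}"
    using moments[OF assms] by (intro has_integral_add has_integral_diff has_integral_mult_right)
  moreover have "(cc t)\<^sup>2 * ss t - (2 * cc t * cs t) * cs t + (cs t)\<^sup>2 * cc t = 0"
    using det by (simp add: algebra_simps power2_eq_square)
  ultimately have "(?f has_integral 0) {0..L}"
    by (elim has_integral_transform) (auto simp: power2_diff power_mult_distrib)
  then have "integral {0..L} ?f = 0" by (rule integral_unique)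
  moreover have "continuous_on {0..L} ?f"
    using assms by (intro continuous_intros) auto
  ultimately have zero: "cc t * sin (\<theta> t s) - cs t * cos (\<theta> t s) = 0" if "s \<in> {0..L}" for s
    using integral_eq_0_iff[of 0 L ?f] L_pos that by auto
  obtain s where s: "s \<in> {0..L}" "cos (\<theta> t s) = 0"
    using sin_shifted_zero[OF assms, of "pi / 2"] by (auto simp: sin_add)
  have "sin (\<theta> t s) \<noteq> 0"
    using s(2) sin_zero_abs_cos_one by force
  then have "cc t = 0" using zero[OF s(1)] s(2) by simp
  moreover have "continuous_on {0..L} (\<lambda>s. (cos (\<theta> t s))\<^sup>2)"
    using assms by (intro continuous_intros) auto
  ultimately have cos0: "cos (\<theta> t s) = 0" if "s \<in> {0..L}" for s
    using integral_eq_0_iff[of 0 L "\<lambda>s. (cos (\<theta> t s))\<^sup>2"] L_pos that by (auto simp: cc_def)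
  obtain s' where "s' \<in> {0..L}" "sin (\<theta> t s') = 0"
    using sin_shifted_zero[OF assms, of 0] by auto
  with cos0[of s'] show False using sin_zero_abs_cos_one by force
qed

lemma multiplier_system:
  assumes "t \<ge> 0"
  shows "ss t * lam1 t - cs t * lam2 t = v1 t" "cc t * lam2 t - cs t * lam1 t = v2 t"
proof -
  let ?A = "Pi_mat L (\<theta> t)"
  let ?v = "vector [v1 t, v2 t] :: real^2"
  have A: "?A = vector [vector [ss t, - cs t], vector [- cs t, cc t]]"
    by (simp add: Pi_mat_def ss_def cs_def cc_def)
  have "det ?A \<noteq> 0"
    using det_nonzero[OF assms] by (simp add: A det_2 power2_eq_square)
  \<comment> \<open>\<open>matrix_inv\<close> is a choice operator, so it is an inverse only once an
    inverse is known to exist.\<close>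
  then have "\<exists>B. ?A ** B = mat 1 \<and> B ** ?A = mat 1"
    by (simp add: invertible_det_nz[symmetric] invertible_def)
  then have "?A ** matrix_inv ?A = mat 1"
    unfolding matrix_inv_def by (rule someI2_ex) simp
  then have "?A *v (matrix_inv ?A *v ?v) = ?v"
    by (simp add: matrix_vector_mul_assoc)
  moreover have "lam_theta L \<beta> c0 (\<theta> t) (\<rho> t) = matrix_inv ?A *v ?v"
    by (simp add: lam_theta_def v1_def v2_def F_def ps_def Let_def mult.assoc)
  ultimately have "?A *v lam_theta L \<beta> c0 (\<theta> t) (\<rho> t) = ?v" by simp
  then have "(?A *v lam_theta L \<beta> c0 (\<theta> t) (\<rho> t)) $ 1 = v1 t"
    "(?A *v lam_theta L \<beta> c0 (\<theta> t) (\<rho> t)) $ 2 = v2 t" by simp_all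
  then show "ss t * lam1 t - cs t * lam2 t = v1 t" "cc t * lam2 t - cs t * lam1 t = v2 t"
    by (simp_all add: A matrix_vector_mult_def sum_2 lam1_def lam2_def)
qed

text \<open>Cramer's rule; the explicit quotients give continuity in time.\<close>

lemma multipliers:
  assumes "t \<ge> 0"
  shows "lam1 t = (cc t * v1 t + cs t * v2 t) / (ss t * cc t - (cs t)\<^sup>2)"
    "lam2 t = (cs t * v1 t + ss t * v2 t) / (ss t * cc t - (cs t)\<^sup>2)"
  using det_nonzero[OF assms] unfolding multiplier_system[OF assms, symmetric]
  by (simp_all add: field_simps power2_eq_square)

lemma cont_multipliers:
  "continuous_on {0..} lam1" "continuous_on {0..} lam2" "continuous_on {0..} lamr"
proof -
  have [continuous_intros]: "continuous_on {0..} ss" "continuous_on {0..} cc" "continuous_on {0..} cs"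
    "continuous_on {0..} v1" "continuous_on {0..} v2"
    unfolding ss_def cc_def cs_def v1_def v2_def
    by (intro continuous_on_integral_param; simp only: case_prod_unfold; intro continuous_intros; auto)+
  have "continuous_on {0..} (\<lambda>t. (cc t * v1 t + cs t * v2 t) / (ss t * cc t - (cs t)\<^sup>2))"
    using det_nonzero by (intro continuous_intros; simp)
  then show "continuous_on {0..} lam1"
    by (rule continuous_on_eq) (simp add: multipliers)
  have "continuous_on {0..} (\<lambda>t. (cs t * v1 t + ss t * v2 t) / (ss t * cc t - (cs t)\<^sup>2))"
    using det_nonzero by (intro continuous_intros; simp)
  then show "continuous_on {0..} lam2"
    by (rule continuous_on_eq) (simp add: multipliers)
  have "continuous_on {0..} (\<lambda>t. integral {0..L} (\<lambda>s. deriv \<beta> (\<rho> t s) * (\<kappa> t s - c0)\<^sup>2))"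
    by (intro continuous_on_integral_param; simp only: case_prod_unfold; intro continuous_intros; auto)
  then show "continuous_on {0..} lamr"
    unfolding lamr_def lam_rho_def ps_def by (intro continuous_intros)
qed

text \<open>The multiplier system says precisely that both integrals have zero time derivative,
  after \<open>Fs\<close> is integrated by parts; they vanish for the datum.\<close>

lemma closed_curve:
  assumes "t \<ge> 0"
  shows "integral {0..L} (\<lambda>s. cos (\<theta> t s)) = 0" "integral {0..L} (\<lambda>s. sin (\<theta> t s)) = 0"
proof -
  let ?C = "\<lambda>t. integral {0..L} (\<lambda>s. cos (\<theta> t s))"
  let ?S = "\<lambda>t. integral {0..L} (\<lambda>s. sin (\<theta> t s))"
  have C': "(?C has_real_derivative 0) (at t)" and S': "(?S has_real_derivative 0) (at t)" if "t > 0" for t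
  proof -
    note m = moments[OF less_imp_le[OF that]]
    have per: "sin (\<theta> t L) = sin (\<theta> t 0)" "cos (\<theta> t L) = cos (\<theta> t 0)"
      using theta_periodic[of t] that by simp_all
    \<comment> \<open>Integration by parts in the form of an exact derivative; the boundary terms of
      \<open>bs\<close> and \<open>bc\<close> cancel by periodicity.\<close>
    have bs: "((\<lambda>s. cos (\<theta> t s) * \<kappa> t s * F t s + sin (\<theta> t s) * Fs t s) has_integral
        sin (\<theta> t L) * F t L - sin (\<theta> t 0) * F t 0) {0..L}"
      using that L_pos
      by (intro fundamental_theorem_of_calculus_real)
         (auto intro!: derivative_eq_intros ds_theta ds_F)
    have bc: "((\<lambda>s. - sin (\<theta> t s) * \<kappa> t s * F t s + cos (\<theta> t s) * Fs t s) has_integral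
        cos (\<theta> t L) * F t L - cos (\<theta> t 0) * F t 0) {0..L}"
      using that L_pos
      by (intro fundamental_theorem_of_calculus_real)
         (auto intro!: derivative_eq_intros ds_theta ds_F)
    have "((\<lambda>s. cos (\<theta> t s) * \<kappa> t s * F t s - (cos (\<theta> t s) * \<kappa> t s * F t s + sin (\<theta> t s) * Fs t s)
        - lam1 t * (sin (\<theta> t s))\<^sup>2 + lam2 t * (cos (\<theta> t s) * sin (\<theta> t s))) has_integral
        v1 t - (sin (\<theta> t L) * F t L - sin (\<theta> t 0) * F t 0) - lam1 t * ss t + lam2 t * cs t) {0..L}"
      by (intro has_integral_add has_integral_diff has_integral_mult_right m bs)
    moreover have "v1 t - (sin (\<theta> t L) * F t L - sin (\<theta> t 0) * F t 0) - lam1 t * ss t + lam2 t * cs t = 0"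
      using multiplier_system(1)[of t] F_periodic[of t] that by (simp add: per algebra_simps)
    ultimately have ic: "((\<lambda>s. - sin (\<theta> t s) * pt \<theta> t s) has_integral 0) {0..L}"
      using that by (elim has_integral_transform)
        (auto simp: pde_theta algebra_simps power2_eq_square)
    have "((\<lambda>s. sin (\<theta> t s) * \<kappa> t s * F t s + (- sin (\<theta> t s) * \<kappa> t s * F t s + cos (\<theta> t s) * Fs t s)
        + lam1 t * (cos (\<theta> t s) * sin (\<theta> t s)) - lam2 t * (cos (\<theta> t s))\<^sup>2) has_integral
        v2 t + (cos (\<theta> t L) * F t L - cos (\<theta> t 0) * F t 0) + lam1 t * cs t - lam2 t * cc t) {0..L}"
      by (intro has_integral_add has_integral_diff has_integral_mult_right m bc)
    moreover have "v2 t + (cos (\<theta> t L) * F t L - cos (\<theta> t 0) * F t 0) + lam1 t * cs t - lam2 t * cc t = 0"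
      using multiplier_system(2)[of t] F_periodic[of t] that by (simp add: per algebra_simps)
    ultimately have isin: "((\<lambda>s. cos (\<theta> t s) * pt \<theta> t s) has_integral 0) {0..L}"
      using that by (elim has_integral_transform)
        (auto simp: pde_theta algebra_simps power2_eq_square)
    have "(?C has_real_derivative integral {0..L} (\<lambda>s. - sin (\<theta> t s) * pt \<theta> t s)) (at t)"
      using that
      by (intro has_real_derivative_integral_param; (simp only: case_prod_unfold)?)
         (auto intro!: derivative_eq_intros dt_theta continuous_intros)
    then show "(?C has_real_derivative 0) (at t)" using integral_unique[OF ic] by simp
    have "(?S has_real_derivative integral {0..L} (\<lambda>s. cos (\<theta> t s) * pt \<theta> t s)) (at t)"
      using that
      by (intro has_real_derivative_integral_param; (simp only: case_prod_unfold)?)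
         (auto intro!: derivative_eq_intros dt_theta continuous_intros)
    then show "(?S has_real_derivative 0) (at t)" using integral_unique[OF isin] by simp
  qed
  have cont: "continuous_on {0..t} ?C" "continuous_on {0..t} ?S" for t
    by (intro continuous_on_integral_param; simp only: case_prod_unfold; intro continuous_intros; auto)+
  have "?C 0 = integral {0..L} (\<lambda>s. cos (\<theta>\<^sub>0 s))" "?S 0 = integral {0..L} (\<lambda>s. sin (\<theta>\<^sub>0 s))"
    by (intro integral_cong; simp add: init)+
  then have 0: "?C 0 = 0" "?S 0 = 0" using datum by (simp_all add: admissible_datum_def)
  show "?C t = 0" using DERIV_isconst_end[of 0 t ?C] cont C' 0 assms by (cases "t = 0") auto
  show "?S t = 0" using DERIV_isconst_end[of 0 t ?S] cont S' 0 assms by (cases "t = 0") auto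
qed

subsection \<open>Rotational symmetry persists\<close>

text \<open>On \<open>[0, T]\<close> the density stays in a compact interval, where \<beta> has a
  positive minimum and \<beta> and its derivative are Lipschitz.\<close>

lemma beta_bounds:
  obtains b B1 B2 where "0 < b"
    "\<And>t s. t \<in> {0..T} \<Longrightarrow> s \<in> {0..L} \<Longrightarrow> b \<le> \<beta> (\<rho> t s)"
    "\<And>t s. t \<in> {0..T} \<Longrightarrow> s \<in> {0..L} \<Longrightarrow> \<bar>deriv \<beta> (\<rho> t s)\<bar> \<le> B1"
    "\<And>t s x. t \<in> {0..T} \<Longrightarrow> s \<in> {0..L} \<Longrightarrow> x \<in> {0..L} \<Longrightarrow>
      \<bar>\<beta> (\<rho> t x) - \<beta> (\<rho> t s)\<bar> \<le> B1 * \<bar>\<rho> t x - \<rho> t s\<bar>"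
    "\<And>t s x. t \<in> {0..T} \<Longrightarrow> s \<in> {0..L} \<Longrightarrow> x \<in> {0..L} \<Longrightarrow>
      \<bar>deriv \<beta> (\<rho> t x) - deriv \<beta> (\<rho> t s)\<bar> \<le> B2 * \<bar>\<rho> t x - \<rho> t s\<bar>"
proof -
  obtain r where r: "\<And>t s. t \<in> {0..T} \<Longrightarrow> s \<in> {0..L} \<Longrightarrow> \<bar>\<rho> t s\<bar> \<le> r"
    by (rule strip_bounded[where T = T and g = \<rho>]) (simp only: case_prod_unfold, intro continuous_intros, auto)
  \<comment> \<open>The absolute value makes \<open>I\<close> nonempty for every
    \<open>r\<close>.\<close>
  define I where "I = {- \<bar>r\<bar>..\<bar>r\<bar>}"
  have rho: "\<rho> t s \<in> I" if "t \<in> {0..T}" "s \<in> {0..L}" for t s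
    using r[OF that] by (auto simp: I_def)
  have "continuous_on I \<beta>" "continuous_on I (deriv \<beta>)"
    by (rule continuous_intros continuous_on_id)+
  have I: "compact I" "I \<noteq> {}" "convex I" by (auto simp: I_def)
  obtain m where m: "m \<in> I" "\<And>x. x \<in> I \<Longrightarrow> \<beta> m \<le> \<beta> x"
    using continuous_attains_inf[OF I(1,2) \<open>continuous_on I \<beta>\<close>] by blast
  have bd: "\<exists>B. \<forall>x\<in>I. norm (f x) \<le> B" if "continuous_on I f" for f :: "real \<Rightarrow> real"
    using compact_imp_bounded[OF compact_continuous_image[OF that I(1)]] by (auto simp: bounded_iff)
  obtain B1 where B1: "\<And>x. x \<in> I \<Longrightarrow> norm (deriv \<beta> x) \<le> B1"
    using bd[OF \<open>continuous_on I (deriv \<beta>)\<close>] by blast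
  obtain B2 where B2: "\<And>x. x \<in> I \<Longrightarrow> norm (deriv (deriv \<beta>) x) \<le> B2"
    using bd[OF continuous_on_subset[OF beta_deriv(3)]] by blast
  have lip: "\<bar>\<beta> x - \<beta> y\<bar> \<le> B1 * \<bar>x - y\<bar>" "\<bar>deriv \<beta> x - deriv \<beta> y\<bar> \<le> B2 * \<bar>x - y\<bar>"
    if "x \<in> I" "y \<in> I" for x y
    using field_differentiable_bound[OF I(3) has_field_derivative_at_within[OF beta_deriv(1)] B1, of y x]
      field_differentiable_bound[OF I(3) has_field_derivative_at_within[OF beta_deriv(2)] B2, of y x] that
    by (simp_all add: abs_minus_commute)
  show ?thesis
    using beta_pos[of m] m(2) B1 lip rho by (intro that[of "\<beta> m" B1 B2]) auto
qed

text \<open>The decrease of the primitive \<open>- lam1 cos - lam2 sin\<close> of the multiplier term under a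
  rotation by \<open>\<alpha>\<close>.\<close>

definition rot_decr :: "real \<Rightarrow> real \<Rightarrow> real \<Rightarrow> real" where
  "rot_decr \<alpha> t x = (- lam1 t * cos x - lam2 t * sin x) - (- lam1 t * cos (x + \<alpha>) - lam2 t * sin (x + \<alpha>))"

text \<open>The integrand of the Gronwall inequality, sorted by fate: a multiple of the energy
  density, a bracket that is an exact \<open>s\<close>-derivative when \<open>x = s + m\<close>, and
  rotation terms that integrate to zero on closed curves. \<open>C\<close> does not depend on
  \<open>x\<close>, \<open>s\<close> or \<alpha>, so it serves all shifts at once.\<close>

lemma two_point_estimate:
  assumes "T \<ge> 0"
  obtains C where "\<And>t x s \<alpha>. 0 < t \<Longrightarrow> t \<le> T \<Longrightarrow> x \<in> {0..L} \<Longrightarrow> s \<in> {0..L} \<Longrightarrow>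
    (\<theta> t x - \<theta> t s - \<alpha>) * (pt \<theta> t x - pt \<theta> t s) + (\<rho> t x - \<rho> t s) * (pt \<rho> t x - pt \<rho> t s) \<le>
    C * ((\<theta> t x - \<theta> t s - \<alpha>)\<^sup>2 + (\<rho> t x - \<rho> t s)\<^sup>2) +
    ((\<kappa> t x - \<kappa> t s) * (F t x - F t s) + (\<theta> t x - \<theta> t s - \<alpha>) * (Fs t x - Fs t s) +
      \<mu> * ((ps L \<rho> t x - ps L \<rho> t s) * (ps L \<rho> t x - ps L \<rho> t s) +
        (\<rho> t x - \<rho> t s) * (ps L (ps L \<rho>) t x - ps L (ps L \<rho>) t s))) +
    (rot_decr (- \<alpha>) t (\<theta> t x) + rot_decr \<alpha> t (\<theta> t s))"
proof -
  obtain K where K: "\<And>t s. t \<in> {0..T} \<Longrightarrow> s \<in> {0..L} \<Longrightarrow> \<bar>\<kappa> t s - c0\<bar> \<le> K"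
    by (rule strip_bounded[where T = T and g = "\<lambda>t s. \<kappa> t s - c0"])
       (simp only: case_prod_unfold, intro continuous_intros, auto)
  obtain b B1 B2 where b: "0 < b"
    "\<And>t s. t \<in> {0..T} \<Longrightarrow> s \<in> {0..L} \<Longrightarrow> b \<le> \<beta> (\<rho> t s)"
    "\<And>t s. t \<in> {0..T} \<Longrightarrow> s \<in> {0..L} \<Longrightarrow> \<bar>deriv \<beta> (\<rho> t s)\<bar> \<le> B1"
    "\<And>t s x. t \<in> {0..T} \<Longrightarrow> s \<in> {0..L} \<Longrightarrow> x \<in> {0..L} \<Longrightarrow>
      \<bar>\<beta> (\<rho> t x) - \<beta> (\<rho> t s)\<bar> \<le> B1 * \<bar>\<rho> t x - \<rho> t s\<bar>"
    "\<And>t s x. t \<in> {0..T} \<Longrightarrow> s \<in> {0..L} \<Longrightarrow> x \<in> {0..L} \<Longrightarrow>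
      \<bar>deriv \<beta> (\<rho> t x) - deriv \<beta> (\<rho> t s)\<bar> \<le> B2 * \<bar>\<rho> t x - \<rho> t s\<bar>"
    by (rule beta_bounds[of T]) blast
  obtain M where M: "\<And>t s. t \<in> {0..T} \<Longrightarrow> s \<in> {0..L} \<Longrightarrow> \<bar>\<bar>lam1 t\<bar> + \<bar>lam2 t\<bar>\<bar> \<le> M"
    by (rule strip_bounded[where T = T and g = "\<lambda>t s. \<bar>lam1 t\<bar> + \<bar>lam2 t\<bar>"])
       (simp only: case_prod_unfold, intro continuous_intros
          continuous_on_compose2[OF cont_multipliers(1)] continuous_on_compose2[OF cont_multipliers(2)], auto)
  define C where "C = max (2 * M) ((B1 * K)\<^sup>2 / b + B2 * K\<^sup>2)"
  show ?thesis
  proof (rule that[of C])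
    fix t x s \<alpha> :: real
    assume t: "0 < t" "t \<le> T" and x: "x \<in> {0..L}" and s: "s \<in> {0..L}"
    then have tT: "t \<in> {0..T}" by simp
    define D where "D = \<theta> t x - \<theta> t s - \<alpha>"
    define R where "R = \<rho> t x - \<rho> t s"
    \<comment> \<open>\<open>P\<close> is a primitive of the multiplier term
      \<open>N\<close>.\<close>
    define P where "P = (\<lambda>y. - lam1 t * cos y - lam2 t * sin y)"
    define N where "N = (\<lambda>y. lam1 t * sin y - lam2 t * cos y)"
    have "- ((\<kappa> t x - \<kappa> t s) * (F t x - F t s)) -
        1 / 2 * R * (deriv \<beta> (\<rho> t x) * (\<kappa> t x - c0)\<^sup>2 - deriv \<beta> (\<rho> t s) * (\<kappa> t s - c0)\<^sup>2)
        \<le> ((B1 * K)\<^sup>2 / b + B2 * K\<^sup>2) * R\<^sup>2"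
      using diffusion_absorbs[of "\<kappa> t x - c0" K "\<kappa> t s - c0" b "\<beta> (\<rho> t x)" "\<beta> (\<rho> t s)" B1 R
          "deriv \<beta> (\<rho> t s)" "deriv \<beta> (\<rho> t x)" B2] K b tT x s
      by (simp add: F_def R_def)
    also have "\<dots> \<le> C * R\<^sup>2" by (intro mult_right_mono) (auto simp: C_def)
    finally have 1: "- ((\<kappa> t x - \<kappa> t s) * (F t x - F t s)) -
        1 / 2 * R * (deriv \<beta> (\<rho> t x) * (\<kappa> t x - c0)\<^sup>2 - deriv \<beta> (\<rho> t s) * (\<kappa> t s - c0)\<^sup>2) \<le> C * R\<^sup>2" .
    have taylor: "\<bar>P (y + d) - P y - N y * d\<bar> \<le> M * d\<^sup>2" for y d
    proof -
      have "\<bar>P (y + d) - P y - N y * d\<bar> \<le> (\<bar>- lam1 t\<bar> + \<bar>- lam2 t\<bar>) * d\<^sup>2"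
        using cos_sin_taylor[of "- lam1 t" y d "- lam2 t"] by (simp add: P_def N_def)
      also have "\<dots> \<le> M * d\<^sup>2" using M[OF tT s] by (intro mult_right_mono) auto
      finally show ?thesis .
    qed
    \<comment> \<open>Taylor expansion from both points: the step \<open>D\<close> leads from
      \<open>\<theta> t s\<close> to \<open>\<theta> t x - \<alpha>\<close>, the step
      \<open>- D\<close> from \<open>\<theta> t x\<close> to
      \<open>\<theta> t s + \<alpha>\<close>.\<close>
    have "P (\<theta> t x - \<alpha>) - P (\<theta> t s) - N (\<theta> t s) * D \<le> M * D\<^sup>2"
      using taylor[of "\<theta> t s" D] by (simp add: D_def abs_le_iff)
    moreover have "P (\<theta> t s + \<alpha>) - P (\<theta> t x) + N (\<theta> t x) * D \<le> M * D\<^sup>2"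
    proof -
      have "\<theta> t x - D = \<theta> t s + \<alpha>" by (simp add: D_def)
      then show ?thesis using taylor[of "\<theta> t x" "- D"] by (simp add: abs_le_iff)
    qed
    moreover have "2 * (M * D\<^sup>2) \<le> C * D\<^sup>2"
      using mult_right_mono[of "2 * M" C "D\<^sup>2"] by (simp add: C_def)
    moreover have "D * (N (\<theta> t x) - N (\<theta> t s)) = N (\<theta> t x) * D - N (\<theta> t s) * D"
      by (simp add: algebra_simps)
    ultimately have 2: "D * (N (\<theta> t x) - N (\<theta> t s)) \<le>
        C * D\<^sup>2 + (P (\<theta> t x) - P (\<theta> t x - \<alpha>) + P (\<theta> t s) - P (\<theta> t s + \<alpha>))"
      by linarith
    have e1: "D * (pt \<theta> t x - pt \<theta> t s) = D * (Fs t x - Fs t s) + D * (N (\<theta> t x) - N (\<theta> t s))"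
      using t x s by (simp add: pde_theta N_def algebra_simps)
    \<comment> \<open>The multiplier \<open>lamr t\<close> does not depend on the point and
      cancels.\<close>
    have e2: "R * (pt \<rho> t x - pt \<rho> t s) = \<mu> * (R * (ps L (ps L \<rho>) t x - ps L (ps L \<rho>) t s)) -
        1 / 2 * R * (deriv \<beta> (\<rho> t x) * (\<kappa> t x - c0)\<^sup>2 - deriv \<beta> (\<rho> t s) * (\<kappa> t s - c0)\<^sup>2)"
      using t x s by (simp add: pde_rho algebra_simps diff_divide_distrib)
    \<comment> \<open>Added on the right to complete the exact derivative of the \<rho>
      flux.\<close>
    have 3: "0 \<le> \<mu> * ((ps L \<rho> t x - ps L \<rho> t s) * (ps L \<rho> t x - ps L \<rho> t s))"
      using mu_pos by simp
    have "D * (pt \<theta> t x - pt \<theta> t s) + R * (pt \<rho> t x - pt \<rho> t s) \<le> C * (D\<^sup>2 + R\<^sup>2) +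
      ((\<kappa> t x - \<kappa> t s) * (F t x - F t s) + D * (Fs t x - Fs t s) +
      \<mu> * ((ps L \<rho> t x - ps L \<rho> t s) * (ps L \<rho> t x - ps L \<rho> t s) +
        R * (ps L (ps L \<rho>) t x - ps L (ps L \<rho>) t s))) +
      (P (\<theta> t x) - P (\<theta> t x - \<alpha>) + P (\<theta> t s) - P (\<theta> t s + \<alpha>))"
      unfolding e1 e2 distrib_left[of C] distrib_left[of \<mu>] using 1 2 3 by linarith
    then show "(\<theta> t x - \<theta> t s - \<alpha>) * (pt \<theta> t x - pt \<theta> t s) + (\<rho> t x - \<rho> t s) * (pt \<rho> t x - pt \<rho> t s) \<le>
    C * ((\<theta> t x - \<theta> t s - \<alpha>)\<^sup>2 + (\<rho> t x - \<rho> t s)\<^sup>2) +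
    ((\<kappa> t x - \<kappa> t s) * (F t x - F t s) + (\<theta> t x - \<theta> t s - \<alpha>) * (Fs t x - Fs t s) +
      \<mu> * ((ps L \<rho> t x - ps L \<rho> t s) * (ps L \<rho> t x - ps L \<rho> t s) +
        (\<rho> t x - \<rho> t s) * (ps L (ps L \<rho>) t x - ps L (ps L \<rho>) t s))) +
    (rot_decr (- \<alpha>) t (\<theta> t x) + rot_decr \<alpha> t (\<theta> t s))" by (simp add: D_def R_def P_def rot_decr_def)
  qed
qed

section \<open>Energy of the difference from the shifted and rotated copy\<close>

text \<open>Shift and angle are separate parameters because the two pieces of a cyclic shift use
  \<open>(h, \<alpha>)\<close> and \<open>(h - L, \<alpha> - 2 * pi)\<close>.\<close>

definition shift_dist :: "real \<Rightarrow> real \<Rightarrow> real \<Rightarrow> real \<Rightarrow> real" where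
  "shift_dist m \<alpha> t s = (\<theta> t (s + m) - \<theta> t s - \<alpha>)\<^sup>2 + (\<rho> t (s + m) - \<rho> t s)\<^sup>2"

definition shift_dist_t :: "real \<Rightarrow> real \<Rightarrow> real \<Rightarrow> real \<Rightarrow> real" where
  "shift_dist_t m \<alpha> t s = 2 * ((\<theta> t (s + m) - \<theta> t s - \<alpha>) * (pt \<theta> t (s + m) - pt \<theta> t s) +
     (\<rho> t (s + m) - \<rho> t s) * (pt \<rho> t (s + m) - pt \<rho> t s))"

text \<open>Its \<open>s\<close>-derivative is the bracket in \<open>two_point_estimate\<close> at
  \<open>x = s + m\<close>.\<close>

definition shift_flux :: "real \<Rightarrow> real \<Rightarrow> real \<Rightarrow> real \<Rightarrow> real" where
  "shift_flux m \<alpha> t s = (\<theta> t (s + m) - \<theta> t s - \<alpha>) * (F t (s + m) - F t s) +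
     \<mu> * ((\<rho> t (s + m) - \<rho> t s) * (ps L \<rho> t (s + m) - ps L \<rho> t s))"

text \<open>As a linear combination of \<open>cos x\<close> and \<open>sin x\<close> it integrates
  to zero on closed curves; the coefficients depend on \<alpha> only modulo 2 pi.\<close>

lemma rot_decr_eq:
  "rot_decr \<alpha> t x = (lam1 t * (cos \<alpha> - 1) + lam2 t * sin \<alpha>) * cos x +
     (lam2 t * (cos \<alpha> - 1) - lam1 t * sin \<alpha>) * sin x"
  by (simp add: rot_decr_def cos_add sin_add algebra_simps)

lemma integral_rot_decr:
  assumes "t \<ge> 0"
  shows "integral {0..L} (\<lambda>s. rot_decr \<alpha> t (\<theta> t s)) = 0"
proof -
  have "(\<lambda>s. cos (\<theta> t s)) integrable_on {0..L}" "(\<lambda>s. sin (\<theta> t s)) integrable_on {0..L}"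
    using assms by (intro integrable_continuous_interval continuous_intros; auto)+
  then have i: "((\<lambda>s. cos (\<theta> t s)) has_integral 0) {0..L}" "((\<lambda>s. sin (\<theta> t s)) has_integral 0) {0..L}"
    using closed_curve[OF assms] by (simp_all add: has_integral_iff)
  have "((\<lambda>s. rot_decr \<alpha> t (\<theta> t s)) has_integral (lam1 t * (cos \<alpha> - 1) + lam2 t * sin \<alpha>) * 0 +
     (lam2 t * (cos \<alpha> - 1) - lam1 t * sin \<alpha>) * 0) {0..L}"
    unfolding rot_decr_eq by (intro has_integral_add has_integral_mult_right i)
  then show ?thesis by (simp add: integral_unique)
qed

lemma shift_energy_estimate:
  assumes "T \<ge> 0"
  obtains C where "\<And>t a b m \<alpha>. 0 < t \<Longrightarrow> t \<le> T \<Longrightarrow> 0 \<le> a \<Longrightarrow> a \<le> b \<Longrightarrow> b \<le> L \<Longrightarrow>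
      0 \<le> a + m \<Longrightarrow> b + m \<le> L \<Longrightarrow>
      integral {a..b} (shift_dist_t m \<alpha> t) \<le> C * integral {a..b} (shift_dist m \<alpha> t) +
        2 * (shift_flux m \<alpha> t b - shift_flux m \<alpha> t a) +
        2 * (integral {a..b} (\<lambda>s. rot_decr (- \<alpha>) t (\<theta> t (s + m))) +
             integral {a..b} (\<lambda>s. rot_decr \<alpha> t (\<theta> t s)))"
proof -
  obtain C where C: "\<And>t x s \<alpha>. 0 < t \<Longrightarrow> t \<le> T \<Longrightarrow> x \<in> {0..L} \<Longrightarrow> s \<in> {0..L} \<Longrightarrow>
    (\<theta> t x - \<theta> t s - \<alpha>) * (pt \<theta> t x - pt \<theta> t s) + (\<rho> t x - \<rho> t s) * (pt \<rho> t x - pt \<rho> t s) \<le>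
    C * ((\<theta> t x - \<theta> t s - \<alpha>)\<^sup>2 + (\<rho> t x - \<rho> t s)\<^sup>2) +
    ((\<kappa> t x - \<kappa> t s) * (F t x - F t s) + (\<theta> t x - \<theta> t s - \<alpha>) * (Fs t x - Fs t s) +
      \<mu> * ((ps L \<rho> t x - ps L \<rho> t s) * (ps L \<rho> t x - ps L \<rho> t s) +
        (\<rho> t x - \<rho> t s) * (ps L (ps L \<rho>) t x - ps L (ps L \<rho>) t s))) +
    (rot_decr (- \<alpha>) t (\<theta> t x) + rot_decr \<alpha> t (\<theta> t s))"
    by (rule two_point_estimate[OF assms]) blast
  show ?thesis
  proof (rule that[of "2 * C"])
    fix t a b m \<alpha> :: real
    assume t: "0 < t" "t \<le> T" and ab: "0 \<le> a" "a \<le> b" "b \<le> L" and m: "0 \<le> a + m" "b + m \<le> L"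
    note sub = has_field_derivative_subset[of _ _ _ "{0..L}" "{a..b}"]
    define g where "g = (\<lambda>s. (\<kappa> t (s + m) - \<kappa> t s) * (F t (s + m) - F t s) +
      (\<theta> t (s + m) - \<theta> t s - \<alpha>) * (Fs t (s + m) - Fs t s) +
      \<mu> * ((ps L \<rho> t (s + m) - ps L \<rho> t s) * (ps L \<rho> t (s + m) - ps L \<rho> t s) +
        (\<rho> t (s + m) - \<rho> t s) * (ps L (ps L \<rho>) t (s + m) - ps L (ps L \<rho>) t s)))"
    have g: "(g has_integral (shift_flux m \<alpha> t b - shift_flux m \<alpha> t a)) {a..b}"
    proof (rule fundamental_theorem_of_calculus_real[OF ab(2)])
      fix s assume s: "s \<in> {a..b}"
      then have s': "s \<in> {0..L}" "s + m \<in> {0..L}" using ab m by auto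
      note d = shifted_derivative[OF _ m]
      have "(\<theta> t has_real_derivative \<kappa> t s) (at s within {a..b})"
        "(F t has_real_derivative Fs t s) (at s within {a..b})"
        "(\<rho> t has_real_derivative ps L \<rho> t s) (at s within {a..b})"
        "(ps L \<rho> t has_real_derivative ps L (ps L \<rho>) t s) (at s within {a..b})"
        using ab t(1) s' by (auto intro!: sub ds_theta ds_F ds_rho dss_rho)
      moreover have "((\<lambda>s. \<theta> t (s + m)) has_real_derivative \<kappa> t (s + m)) (at s within {a..b})"
        "((\<lambda>s. F t (s + m)) has_real_derivative Fs t (s + m)) (at s within {a..b})"
        "((\<lambda>s. \<rho> t (s + m)) has_real_derivative ps L \<rho> t (s + m)) (at s within {a..b})"
        "((\<lambda>s. ps L \<rho> t (s + m)) has_real_derivative ps L (ps L \<rho>) t (s + m)) (at s within {a..b})"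
        using t(1) s' by (auto intro!: d ds_theta ds_F ds_rho dss_rho)
      ultimately show "(shift_flux m \<alpha> t has_real_derivative g s) (at s within {a..b})"
        unfolding shift_flux_def g_def
        by (auto intro!: derivative_eq_intros simp: algebra_simps)
    qed
    have rc: "continuous_on S (\<lambda>s. rot_decr x t (f s))" if "continuous_on S f" for x and S :: "real set" and f
      unfolding rot_decr_def by (intro continuous_intros that)
    have i1: "(shift_dist_t m \<alpha> t has_integral integral {a..b} (shift_dist_t m \<alpha> t)) {a..b}"
      unfolding shift_dist_t_def using t ab m
      by (intro integrable_integral integrable_continuous_interval continuous_intros) auto
    have i2: "(shift_dist m \<alpha> t has_integral integral {a..b} (shift_dist m \<alpha> t)) {a..b}"
      unfolding shift_dist_def using t ab m
      by (intro integrable_integral integrable_continuous_interval continuous_intros) auto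
    have i3: "((\<lambda>s. rot_decr (- \<alpha>) t (\<theta> t (s + m))) has_integral
        integral {a..b} (\<lambda>s. rot_decr (- \<alpha>) t (\<theta> t (s + m)))) {a..b}"
      using t ab m
      by (intro integrable_integral integrable_continuous_interval rc continuous_intros) auto
    have i4: "((\<lambda>s. rot_decr \<alpha> t (\<theta> t s)) has_integral
        integral {a..b} (\<lambda>s. rot_decr \<alpha> t (\<theta> t s))) {a..b}"
      using t ab m
      by (intro integrable_integral integrable_continuous_interval rc continuous_intros) auto
    have "((\<lambda>s. (2 * C) * shift_dist m \<alpha> t s + 2 * g s +
        2 * (rot_decr (- \<alpha>) t (\<theta> t (s + m)) + rot_decr \<alpha> t (\<theta> t s))) has_integral
      (2 * C) * integral {a..b} (shift_dist m \<alpha> t) +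
        2 * (shift_flux m \<alpha> t b - shift_flux m \<alpha> t a) +
        2 * (integral {a..b} (\<lambda>s. rot_decr (- \<alpha>) t (\<theta> t (s + m))) +
             integral {a..b} (\<lambda>s. rot_decr \<alpha> t (\<theta> t s)))) {a..b}"
      by (intro has_integral_add has_integral_mult_right i2 i3 i4 g)
    then show "integral {a..b} (shift_dist_t m \<alpha> t) \<le> 2 * C * integral {a..b} (shift_dist m \<alpha> t) +
        2 * (shift_flux m \<alpha> t b - shift_flux m \<alpha> t a) +
        2 * (integral {a..b} (\<lambda>s. rot_decr (- \<alpha>) t (\<theta> t (s + m))) +
             integral {a..b} (\<lambda>s. rot_decr \<alpha> t (\<theta> t s)))"
    proof (rule has_integral_le[OF i1])
      fix s assume "s \<in> {a..b}"
      then have s': "s \<in> {0..L}" "s + m \<in> {0..L}" using ab m by auto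
      show "shift_dist_t m \<alpha> t s \<le> (2 * C) * shift_dist m \<alpha> t s + 2 * g s +
        2 * (rot_decr (- \<alpha>) t (\<theta> t (s + m)) + rot_decr \<alpha> t (\<theta> t s))"
        using mult_left_mono[OF C[OF t s'(2,1), of \<alpha>], of 2]
        by (simp add: shift_dist_def shift_dist_t_def g_def algebra_simps)
    qed
  qed
qed

lemma shift_energy_derivative:
  assumes "0 \<le> a" "b \<le> L" "0 \<le> a + m" "b + m \<le> L" "t > 0"
  shows "((\<lambda>t. integral {a..b} (shift_dist m \<alpha> t)) has_real_derivative
    integral {a..b} (shift_dist_t m \<alpha> t)) (at t)"
proof (rule has_real_derivative_integral_param)
  fix t s :: real assume "t > 0" "s \<in> {a..b}"
  with assms have "((\<lambda>t. \<theta> t s) has_real_derivative pt \<theta> t s) (at t)"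
    "((\<lambda>t. \<theta> t (s + m)) has_real_derivative pt \<theta> t (s + m)) (at t)"
    "((\<lambda>t. \<rho> t s) has_real_derivative pt \<rho> t s) (at t)"
    "((\<lambda>t. \<rho> t (s + m)) has_real_derivative pt \<rho> t (s + m)) (at t)"
    by (auto intro!: dt_theta dt_rho)
  then show "((\<lambda>t. shift_dist m \<alpha> t s) has_real_derivative shift_dist_t m \<alpha> t s) (at t)"
    unfolding shift_dist_def shift_dist_t_def
    by (auto intro!: derivative_eq_intros simp: algebra_simps)
next
  fix t :: real assume "t > 0"
  then show "continuous_on {a..b} (shift_dist m \<alpha> t)"
    unfolding shift_dist_def using assms by (intro continuous_intros) auto
next
  show "continuous_on ({0<..} \<times> {a..b}) (\<lambda>(t, s). shift_dist_t m \<alpha> t s)"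
    unfolding shift_dist_t_def case_prod_unfold using assms by (intro continuous_intros) auto
qed (use assms in auto)

lemma shift_energy_continuous:
  assumes "0 \<le> a" "b \<le> L" "0 \<le> a + m" "b + m \<le> L"
  shows "continuous_on {0..} (\<lambda>t. integral {a..b} (shift_dist m \<alpha> t))"
  unfolding shift_dist_def
  by (intro continuous_on_integral_param; simp only: case_prod_unfold; intro continuous_intros)
     (use assms in auto)

text \<open>Gronwall for the energy summed over both pieces. Only the sum closes up: the boundary
  fluxes of the pieces cancel each other, and the rotation terms combine to integrals over the whole
  closed curve.\<close>

lemma symmetry_persists:
  assumes h: "0 < h" "h < L"
    and init1: "\<And>s. s \<in> {0..L - h} \<Longrightarrow> \<theta>\<^sub>0 (s + h) = \<theta>\<^sub>0 s + \<alpha> \<and> \<rho>\<^sub>0 (s + h) = \<rho>\<^sub>0 s"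
    and init2: "\<And>s. s \<in> {L - h..L} \<Longrightarrow>
      \<theta>\<^sub>0 (s + (h - L)) = \<theta>\<^sub>0 s + (\<alpha> - 2 * pi) \<and> \<rho>\<^sub>0 (s + (h - L)) = \<rho>\<^sub>0 s"
    and "T > 0"
  shows "s \<in> {0..L - h} \<Longrightarrow> \<theta> T (s + h) = \<theta> T s + \<alpha> \<and> \<rho> T (s + h) = \<rho> T s"
    and "s \<in> {L - h..L} \<Longrightarrow> \<theta> T (s + (h - L)) = \<theta> T s + (\<alpha> - 2 * pi) \<and> \<rho> T (s + (h - L)) = \<rho> T s"
proof -
  define E where "E = (\<lambda>t. integral {0..L - h} (shift_dist h \<alpha> t) +
    integral {L - h..L} (shift_dist (h - L) (\<alpha> - 2 * pi) t))"
  define E' where "E' = (\<lambda>t. integral {0..L - h} (shift_dist_t h \<alpha> t) +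
    integral {L - h..L} (shift_dist_t (h - L) (\<alpha> - 2 * pi) t))"
  obtain C where C: "\<And>t a b m \<alpha>. 0 < t \<Longrightarrow> t \<le> T \<Longrightarrow> 0 \<le> a \<Longrightarrow> a \<le> b \<Longrightarrow> b \<le> L \<Longrightarrow>
      0 \<le> a + m \<Longrightarrow> b + m \<le> L \<Longrightarrow>
      integral {a..b} (shift_dist_t m \<alpha> t) \<le> C * integral {a..b} (shift_dist m \<alpha> t) +
        2 * (shift_flux m \<alpha> t b - shift_flux m \<alpha> t a) +
        2 * (integral {a..b} (\<lambda>s. rot_decr (- \<alpha>) t (\<theta> t (s + m))) +
             integral {a..b} (\<lambda>s. rot_decr \<alpha> t (\<theta> t s)))"
    by (rule shift_energy_estimate[OF less_imp_le[OF \<open>T > 0\<close>]]) blast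
  have "E T \<le> 0"
  proof (rule gronwall_zero[where E = E and T = T and E' = E' and C = C])
    show "continuous_on {0..T} E"
      unfolding E_def using h
      by (intro continuous_intros continuous_on_subset[OF shift_energy_continuous]) auto
    show "(E has_real_derivative E' t) (at t)" if "0 < t" "t < T" for t
      unfolding E_def E'_def using h that by (intro derivative_intros shift_energy_derivative) auto
    have z1: "shift_dist h \<alpha> 0 s = 0" if "s \<in> {0..L - h}" for s
      using init1[OF that] that h by (simp add: shift_dist_def init)
    have z2: "shift_dist (h - L) (\<alpha> - 2 * pi) 0 s = 0" if "s \<in> {L - h..L}" for s
      using init2[OF that] that h by (simp add: shift_dist_def init)
    have "integral {0..L - h} (shift_dist h \<alpha> 0) = integral {0..L - h} (\<lambda>_. 0)"
      by (intro integral_cong z1)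
    moreover have "integral {L - h..L} (shift_dist (h - L) (\<alpha> - 2 * pi) 0) = integral {L - h..L} (\<lambda>_. 0)"
      by (intro integral_cong z2)
    ultimately show "E 0 = 0" by (simp add: E_def)
    show "E' t \<le> C * E t" if t: "0 < t" "t < T" for t
    proof -
      have ri: "rot_decr (x - 2 * pi) t y = rot_decr x t y" "rot_decr (2 * pi - x) t y = rot_decr (- x) t y" for x y
        by (simp_all add: rot_decr_eq cos_diff sin_diff)
      have rc: "continuous_on {0..L} (\<lambda>s. rot_decr x t (\<theta> t s))" for x
        unfolding rot_decr_def using t by (intro continuous_intros) auto
      have "integral {0..L - h} (\<lambda>s. rot_decr (- \<alpha>) t (\<theta> t (s + h))) +
          integral {L - h..L} (\<lambda>s. rot_decr (- \<alpha>) t (\<theta> t (s + (h - L)))) = 0"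
        using integral_add_shifted[OF h rc[of "- \<alpha>"]] integral_rot_decr[of t "- \<alpha>"] t by simp
      moreover have "integral {0..L - h} (\<lambda>s. rot_decr \<alpha> t (\<theta> t s)) +
          integral {L - h..L} (\<lambda>s. rot_decr \<alpha> t (\<theta> t s)) = 0"
        using Henstock_Kurzweil_Integration.integral_combine[where a = 0 and c = "L - h" and b = L,
            OF _ _ integrable_continuous_interval[OF rc[of \<alpha>]]]
          integral_rot_decr[of t \<alpha>] t h by simp
      \<comment> \<open>At the junction one piece evaluates at \<open>L\<close> and the other at
        \<open>0\<close>; the jump 2 pi of \<theta> matches the change of angle. The outer end
        points match in the same way.\<close>
      moreover have "shift_flux h \<alpha> t (L - h) = shift_flux (h - L) (\<alpha> - 2 * pi) t (L - h)"
        "shift_flux h \<alpha> t 0 = shift_flux (h - L) (\<alpha> - 2 * pi) t L"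
        using t theta_periodic[of t]
        by (simp_all add: shift_flux_def F_periodic rho_periodic rhos_periodic)
      moreover have "integral {0..L - h} (shift_dist_t h \<alpha> t) \<le> C * integral {0..L - h} (shift_dist h \<alpha> t) +
        2 * (shift_flux h \<alpha> t (L - h) - shift_flux h \<alpha> t 0) +
        2 * (integral {0..L - h} (\<lambda>s. rot_decr (- \<alpha>) t (\<theta> t (s + h))) +
             integral {0..L - h} (\<lambda>s. rot_decr \<alpha> t (\<theta> t s)))"
        using t h by (intro C) auto
      moreover have "integral {L - h..L} (shift_dist_t (h - L) (\<alpha> - 2 * pi) t) \<le>
        C * integral {L - h..L} (shift_dist (h - L) (\<alpha> - 2 * pi) t) +
        2 * (shift_flux (h - L) (\<alpha> - 2 * pi) t L - shift_flux (h - L) (\<alpha> - 2 * pi) t (L - h)) +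
        2 * (integral {L - h..L} (\<lambda>s. rot_decr (- \<alpha>) t (\<theta> t (s + (h - L)))) +
             integral {L - h..L} (\<lambda>s. rot_decr \<alpha> t (\<theta> t s)))"
        using C[of t "L - h" L "h - L" "\<alpha> - 2 * pi"] t h by (simp add: ri)
      ultimately show ?thesis unfolding E_def E'_def distrib_left by argo
    qed
  qed (use \<open>T > 0\<close> in auto)
  have c1: "continuous_on {0..L - h} (shift_dist h \<alpha> T)"
    and c2: "continuous_on {L - h..L} (shift_dist (h - L) (\<alpha> - 2 * pi) T)"
    unfolding shift_dist_def using h \<open>T > 0\<close> by (intro continuous_intros; auto)+
  have nn: "shift_dist m x T s \<ge> 0" for m x s by (simp add: shift_dist_def)
  have "integral {0..L - h} (shift_dist h \<alpha> T) \<ge> 0"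
    "integral {L - h..L} (shift_dist (h - L) (\<alpha> - 2 * pi) T) \<ge> 0"
    by (intro integral_nonneg integrable_continuous_interval c1 c2 nn)+
  with \<open>E T \<le> 0\<close> have "integral {0..L - h} (shift_dist h \<alpha> T) = 0"
    "integral {L - h..L} (shift_dist (h - L) (\<alpha> - 2 * pi) T) = 0"
    by (auto simp: E_def)
  note zero = this
  have z1: "shift_dist h \<alpha> T s = 0" if "s \<in> {0..L - h}" for s
    using integral_eq_0_iff[OF c1 _ nn] zero(1) h that by auto
  have z2: "shift_dist (h - L) (\<alpha> - 2 * pi) T s = 0" if "s \<in> {L - h..L}" for s
    using integral_eq_0_iff[OF c2 _ nn] zero(2) h that by auto
  show "\<theta> T (s + h) = \<theta> T s + \<alpha> \<and> \<rho> T (s + h) = \<rho> T s" if "s \<in> {0..L - h}"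
    using z1[OF that] by (auto simp: shift_dist_def sum_power2_eq_zero_iff)
  show "\<theta> T (s + (h - L)) = \<theta> T s + (\<alpha> - 2 * pi) \<and> \<rho> T (s + (h - L)) = \<rho> T s" if "s \<in> {L - h..L}"
    using z2[OF that] by (auto simp: shift_dist_def sum_power2_eq_zero_iff)
qed

section \<open>Symmetry annihilates the tangential multipliers\<close>

text \<open>The cyclic shift turns \<open>(v1 t, v2 t)\<close> by the angle \<alpha> and leaves the
  integrals unchanged, so this vector is fixed by a nontrivial rotation and is zero.\<close>

lemma multipliers_vanish:
  assumes h: "0 < h" "h < L" and "cos \<alpha> \<noteq> 1" and t: "t > 0"
    and sym1: "\<And>s. s \<in> {0..L - h} \<Longrightarrow> \<theta> t (s + h) = \<theta> t s + \<alpha> \<and> \<rho> t (s + h) = \<rho> t s"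
    and sym2: "\<And>s. s \<in> {L - h..L} \<Longrightarrow>
      \<theta> t (s + (h - L)) = \<theta> t s + (\<alpha> - 2 * pi) \<and> \<rho> t (s + (h - L)) = \<rho> t s"
  shows "lam1 t = 0" "lam2 t = 0"
proof -
  have kappa: "\<kappa> t (s + m) = \<kappa> t s"
    if eq: "\<And>s. s \<in> {a..b} \<Longrightarrow> \<theta> t (s + m) = \<theta> t s + x" and s: "s \<in> {a..b}"
      and ab: "0 \<le> a" "a < b" "b \<le> L" "0 \<le> a + m" "b + m \<le> L" for a b m x s
  proof -
    have "((\<lambda>s. \<theta> t (s + m)) has_real_derivative \<kappa> t (s + m)) (at s within {a..b})"
      using s ab t by (intro shifted_derivative[where L = L] ds_theta) auto
    moreover have "((\<lambda>s. \<theta> t s + x) has_real_derivative \<kappa> t s) (at s within {a..b})"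
      using DERIV_subset[OF ds_theta[of t s], of "{a..b}"] s ab t
      by (auto intro!: derivative_eq_intros)
    then have "((\<lambda>s. \<theta> t (s + m)) has_real_derivative \<kappa> t s) (at s within {a..b})"
      by (rule has_field_derivative_transform_within[where d = 1]) (use s in \<open>auto simp: eq\<close>)
    ultimately show ?thesis
      using deriv_within_eqI[OF ab(2) s] by metis
  qed
  have k1: "\<kappa> t (s + h) = \<kappa> t s" if "s \<in> {0..L - h}" for s
    using kappa[of 0 "L - h" h \<alpha> s] sym1 that h by auto
  have k2: "\<kappa> t (s + (h - L)) = \<kappa> t s" if "s \<in> {L - h..L}" for s
    using kappa[of "L - h" L "h - L" "\<alpha> - 2 * pi" s] sym2 that h by auto
  \<comment> \<open>Change of variables by the cyclic shift, for an \<open>f\<close> whose shifted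
    values are a combination of \<open>g1\<close> and \<open>g2\<close>.\<close>
  have rotate: "integral {0..L} f = p * integral {0..L} g1 + q * integral {0..L} g2"
    if c: "continuous_on {0..L} f" "continuous_on {0..L} g1" "continuous_on {0..L} g2"
      and e: "\<And>s. s \<in> {0..L - h} \<Longrightarrow> f (s + h) = p * g1 s + q * g2 s"
        "\<And>s. s \<in> {L - h..L} \<Longrightarrow> f (s + (h - L)) = p * g1 s + q * g2 s"
    for f g1 g2 :: "real \<Rightarrow> real" and p q
  proof -
    have g: "continuous_on {0..L} (\<lambda>s. p * g1 s + q * g2 s)"
      by (intro continuous_intros c)
    have "integral {0..L} f = integral {0..L - h} (\<lambda>s. f (s + h)) + integral {L - h..L} (\<lambda>s. f (s + (h - L)))"
      using integral_add_shifted[OF h c(1)] by simp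
    also have "integral {0..L - h} (\<lambda>s. f (s + h)) = integral {0..L - h} (\<lambda>s. p * g1 s + q * g2 s)"
      by (intro integral_cong e)
    also have "integral {L - h..L} (\<lambda>s. f (s + (h - L))) = integral {L - h..L} (\<lambda>s. p * g1 s + q * g2 s)"
      by (intro integral_cong e)
    also have "integral {0..L - h} (\<lambda>s. p * g1 s + q * g2 s) + integral {L - h..L} (\<lambda>s. p * g1 s + q * g2 s)
        = integral {0..L} (\<lambda>s. p * g1 s + q * g2 s)"
      using h by (intro Henstock_Kurzweil_Integration.integral_combine integrable_continuous_interval g) auto
    also have "\<dots> = p * integral {0..L} g1 + q * integral {0..L} g2"
      by (intro integral_unique has_integral_add has_integral_mult_right integrable_integral
          integrable_continuous_interval c)
    finally show ?thesis .
  qed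
  let ?f1 = "\<lambda>s. cos (\<theta> t s) * \<kappa> t s * F t s" and ?f2 = "\<lambda>s. sin (\<theta> t s) * \<kappa> t s * F t s"
  have c: "continuous_on {0..L} ?f1" "continuous_on {0..L} ?f2"
    using t by (intro continuous_intros; auto)+
  have tr: "cos (x + (\<alpha> - 2 * pi)) = cos (x + \<alpha>)" "sin (x + (\<alpha> - 2 * pi)) = sin (x + \<alpha>)" for x
    by (simp_all add: cos_add sin_add cos_diff sin_diff)
  have "v1 t = cos \<alpha> * v1 t + (- sin \<alpha>) * v2 t"
    unfolding v1_def v2_def
    by (intro rotate c)
       (simp_all add: sym1 sym2 k1 k2 F_def tr, simp_all add: cos_add algebra_simps)
  moreover have "v2 t = cos \<alpha> * v2 t + sin \<alpha> * v1 t"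
    unfolding v1_def v2_def
    by (intro rotate c)
       (simp_all add: sym1 sym2 k1 k2 F_def tr, simp_all add: sin_add algebra_simps)
  ultimately have e: "(1 - cos \<alpha>) * v1 t = - sin \<alpha> * v2 t" "(1 - cos \<alpha>) * v2 t = sin \<alpha> * v1 t"
    by (simp_all add: algebra_simps)
  \<comment> \<open>The determinant of the identity minus the rotation by \<alpha>.\<close>
  have pos: "(1 - cos \<alpha>)\<^sup>2 + (sin \<alpha>)\<^sup>2 \<noteq> 0"
    using \<open>cos \<alpha> \<noteq> 1\<close> by (simp add: sum_power2_eq_zero_iff)
  have "((1 - cos \<alpha>)\<^sup>2 + (sin \<alpha>)\<^sup>2) * v1 t =
      (1 - cos \<alpha>) * ((1 - cos \<alpha>) * v1 t) + sin \<alpha> * (sin \<alpha> * v1 t)"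
    by (simp only: power2_eq_square distrib_right mult.assoc mult_minus_left mult_minus_right diff_minus_eq_add)
  also have "\<dots> = (1 - cos \<alpha>) * (- sin \<alpha> * v2 t) + sin \<alpha> * ((1 - cos \<alpha>) * v2 t)"
    by (subst e(1), subst e(2), rule refl)
  also have "\<dots> = 0" by (simp add: algebra_simps)
  finally have "v1 t = 0" using pos by auto
  have "((1 - cos \<alpha>)\<^sup>2 + (sin \<alpha>)\<^sup>2) * v2 t =
      (1 - cos \<alpha>) * ((1 - cos \<alpha>) * v2 t) - sin \<alpha> * (- sin \<alpha> * v2 t)"
    by (simp only: power2_eq_square distrib_right mult.assoc mult_minus_left mult_minus_right diff_minus_eq_add)
  also have "\<dots> = (1 - cos \<alpha>) * (sin \<alpha> * v1 t) - sin \<alpha> * ((1 - cos \<alpha>) * v1 t)"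
    by (subst e(2), subst e(1), rule refl)
  also have "\<dots> = 0" by (simp add: algebra_simps)
  finally have "v2 t = 0" using pos by auto
  show "lam1 t = 0" "lam2 t = 0"
    using \<open>v1 t = 0\<close> \<open>v2 t = 0\<close> t by (simp_all add: multipliers)
qed

text \<open>Unfolds the periodic extension into the two pieces of the shift; the linear part of
  \<theta> contributes the angles.\<close>

lemma initial_symmetry:
  assumes "k \<ge> 2" "rot_symmetric L k \<theta>\<^sub>0 \<rho>\<^sub>0"
  shows "s \<in> {0..L - L / real k} \<Longrightarrow>
      \<theta>\<^sub>0 (s + L / real k) = \<theta>\<^sub>0 s + 2 * pi / real k \<and> \<rho>\<^sub>0 (s + L / real k) = \<rho>\<^sub>0 s"
    and "s \<in> {L - L / real k..L} \<Longrightarrow>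
      \<theta>\<^sub>0 (s + (L / real k - L)) = \<theta>\<^sub>0 s + (2 * pi / real k - 2 * pi) \<and>
      \<rho>\<^sub>0 (s + (L / real k - L)) = \<rho>\<^sub>0 s"
proof -
  let ?h = "L / real k"
  let ?f = "\<lambda>x. \<theta>\<^sub>0 x - 2 * pi * x / L"
  have h: "0 < ?h" "?h < L" using assms(1) L_pos by (auto simp: field_simps)
  \<comment> \<open>\<open>L rmod L\<close> is 0, so at the right end point the value agrees only
    because \<open>f L = f 0\<close>.\<close>
  have ext: "periodic_ext L f x = f x" if "x \<in> {0..L}" "f L = f 0" for f and x :: real
  proof (cases "x = L")
    case True then show ?thesis using that by (simp add: periodic_ext_def)
  next
    case False then show ?thesis
      using that rmod_unique[of x L x 0] L_pos by (auto simp: periodic_ext_def)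
  qed
  have ext': "periodic_ext L f x = f (x - L)" if "x \<in> {L..<2 * L}" for f and x :: real
    using that rmod_unique[of "x - L" L x 1] L_pos by (auto simp: periodic_ext_def)
  have per: "?f L = ?f 0" "\<rho>\<^sub>0 L = \<rho>\<^sub>0 0"
    using datum L_pos by (auto simp: admissible_datum_def)
  have sym: "periodic_ext L ?f (s + ?h) = periodic_ext L ?f s"
    "periodic_ext L \<rho>\<^sub>0 (s + ?h) = periodic_ext L \<rho>\<^sub>0 s" for s
    using assms(2) by (auto simp: rot_symmetric_def)
  show "\<theta>\<^sub>0 (s + ?h) = \<theta>\<^sub>0 s + 2 * pi / real k \<and> \<rho>\<^sub>0 (s + ?h) = \<rho>\<^sub>0 s" if s: "s \<in> {0..L - ?h}"
  proof -
    have "s \<in> {0..L}" "s + ?h \<in> {0..L}" using s h by auto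
    then have "?f (s + ?h) = ?f s" "\<rho>\<^sub>0 (s + ?h) = \<rho>\<^sub>0 s"
      using sym[of s] ext[of s ?f] ext[of "s + ?h" ?f] ext[of s \<rho>\<^sub>0] ext[of "s + ?h" \<rho>\<^sub>0] per
      by simp_all
    then show ?thesis using L_pos by (simp add: add_divide_distrib distrib_left)
  qed
  show "\<theta>\<^sub>0 (s + (?h - L)) = \<theta>\<^sub>0 s + (2 * pi / real k - 2 * pi) \<and> \<rho>\<^sub>0 (s + (?h - L)) = \<rho>\<^sub>0 s"
    if s: "s \<in> {L - ?h..L}"
  proof -
    have "s \<in> {0..L}" "s + ?h \<in> {L..<2 * L}" using s h by auto
    then have "?f (s + ?h - L) = ?f s" "\<rho>\<^sub>0 (s + ?h - L) = \<rho>\<^sub>0 s"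
      using sym[of s] ext[of s ?f] ext'[of "s + ?h" ?f] ext[of s \<rho>\<^sub>0] ext'[of "s + ?h" \<rho>\<^sub>0] per
      by simp_all
    moreover have "s + ?h - L = s + (?h - L)" by simp
    ultimately show ?thesis
      using L_pos by (simp add: add_divide_distrib diff_divide_distrib distrib_left right_diff_distrib)
  qed
qed

subsection \<open>The minimum principle\<close>

text \<open>Without multipliers \<open>\<kappa>\<^sub>t = F\<^sub>s\<^sub>s\<close>, so \<open>F = \<beta>(\<rho>) (\<kappa> - c0)\<close> solves the linear parabolic equation
  \<open>F\<^sub>t = \<beta>(\<rho>) F\<^sub>s\<^sub>s + (\<beta>'(\<rho>) \<rho>\<^sub>t / \<beta>(\<rho>)) F\<close> with a potential that stays bounded down to \<open>t = 0\<close>.\<close>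

lemma sign_F_persists:
  fixes \<sigma> :: real
  assumes lam: "\<And>t. t > 0 \<Longrightarrow> lam1 t = 0" "\<And>t. t > 0 \<Longrightarrow> lam2 t = 0"
    and init: "\<And>s. s \<in> {0..L} \<Longrightarrow> 0 \<le> \<sigma> * F 0 s"
    and "T \<ge> 0" "s \<in> {0..L}"
  shows "0 \<le> \<sigma> * F T s"
proof -
  have Fs: "Fs t x = pt \<theta> t x" if "t > 0" "x \<in> {0..L}" for t x
    using pde_theta[OF that] lam that by simp
  \<comment> \<open>The right-hand side of the equation replaces \<open>pt \<rho>\<close>, because
    it is continuous up to \<open>t = 0\<close> and hence bounded on the closed strip.\<close>
  define c where "c = (\<lambda>t s. deriv \<beta> (\<rho> t s) *
    (\<mu> * ps L (ps L \<rho>) t s - 1 / 2 * deriv \<beta> (\<rho> t s) * (\<kappa> t s - c0)\<^sup>2 - lamr t) / \<beta> (\<rho> t s))"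
  have "continuous_on ({0..T} \<times> {0..L}) (\<lambda>(t, s). c t s)"
    unfolding c_def case_prod_unfold
    by (intro continuous_intros continuous_on_compose2[OF cont_multipliers(3)])
       (use beta_pos in \<open>auto simp: less_imp_neq[THEN not_sym]\<close>)
  then obtain C where C: "\<And>t s. t \<in> {0..T} \<Longrightarrow> s \<in> {0..L} \<Longrightarrow> \<bar>c t s\<bar> \<le> C"
    by (rule strip_bounded) blast
  show ?thesis
  proof (rule parabolic_minimum_principle[where G = "\<lambda>t s. \<sigma> * F t s" and T = T and L = L and C = C
      and Gt = "\<lambda>t s. \<sigma> * (deriv \<beta> (\<rho> t s) * pt \<rho> t s * (\<kappa> t s - c0) + \<beta> (\<rho> t s) * pt \<kappa> t s)"
      and Gs = "\<lambda>t s. \<sigma> * pt \<theta> t s" and Gss = "\<lambda>t s. \<sigma> * pt \<kappa> t s"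
      and a = "\<lambda>t s. \<beta> (\<rho> t s)" and c = c])
    show "continuous_on ({0..T} \<times> {0..L}) (\<lambda>(t, s). \<sigma> * F t s)"
      unfolding case_prod_unfold by (intro continuous_intros) auto
  next
    fix t s assume t: "0 < t" "t \<le> T" and s: "s \<in> {0..L}"
    show "((\<lambda>\<tau>. \<sigma> * F \<tau> s) has_real_derivative
        \<sigma> * (deriv \<beta> (\<rho> t s) * pt \<rho> t s * (\<kappa> t s - c0) + \<beta> (\<rho> t s) * pt \<kappa> t s)) (at t)"
      by (intro DERIV_cmult dt_F t s)
    show "((\<lambda>s. \<sigma> * F t s) has_real_derivative \<sigma> * pt \<theta> t s) (at s within {0..L})"
      using ds_F[OF t(1) s] Fs[OF t(1) s] by (intro DERIV_cmult) simp
    show "((\<lambda>s. \<sigma> * pt \<theta> t s) has_real_derivative \<sigma> * pt \<kappa> t s) (at s within {0..L})"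
      by (intro DERIV_cmult mixed_derivative t s)
    have "c t s = deriv \<beta> (\<rho> t s) * pt \<rho> t s / \<beta> (\<rho> t s)"
      by (simp add: c_def pde_rho[OF t(1) s])
    then show "\<sigma> * (deriv \<beta> (\<rho> t s) * pt \<rho> t s * (\<kappa> t s - c0) + \<beta> (\<rho> t s) * pt \<kappa> t s) =
        \<beta> (\<rho> t s) * (\<sigma> * pt \<kappa> t s) + c t s * (\<sigma> * F t s)"
      using beta_pos[of "\<rho> t s"] by (simp add: F_def distrib_left mult_ac)
    show "0 \<le> \<beta> (\<rho> t s)" using beta_pos by (rule less_imp_le)
    show "c t s \<le> C" using C[of t s] t s by auto
  next
    fix t assume t: "0 < t" "t \<le> T"
    show "\<sigma> * F t 0 = \<sigma> * F t L" by (simp add: F_periodic t)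
    \<comment> \<open>Periodicity of \<open>Fs\<close>, here equal to \<open>pt \<theta>\<close>,
      comes from differentiating the boundary condition for \<theta> in time.\<close>
    have "((\<lambda>\<tau>. \<theta> \<tau> L) has_real_derivative pt \<theta> t L) (at t)"
      using t L_pos by (intro dt_theta) auto
    moreover have "((\<lambda>\<tau>. \<theta> \<tau> 0 + 2 * pi) has_real_derivative pt \<theta> t 0) (at t)"
      using dt_theta[of t 0] t L_pos by (auto intro!: derivative_eq_intros)
    then have "((\<lambda>\<tau>. \<theta> \<tau> L) has_real_derivative pt \<theta> t 0) (at t)"
      by (rule has_field_derivative_transform_within_open[where S = "{0<..}"])
         (use t in \<open>auto simp: theta_periodic\<close>)
    ultimately show "\<sigma> * pt \<theta> t 0 = \<sigma> * pt \<theta> t L" by (metis DERIV_unique)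
  qed (use assms L_pos in auto)
qed

lemma multipliers_zero_of_symmetric:
  assumes "k \<ge> 2" "rot_symmetric L k \<theta>\<^sub>0 \<rho>\<^sub>0" "t > 0"
  shows "lam1 t = 0" "lam2 t = 0"
proof -
  let ?h = "L / real k"
  let ?\<alpha> = "2 * pi / real k"
  have h: "0 < ?h" "?h < L" using assms(1) L_pos by (auto simp: field_simps)
  have "0 < ?\<alpha>" "?\<alpha> \<le> pi" using assms(1) by (auto simp: field_simps)
  then have "cos ?\<alpha> < cos 0" by (intro cos_monotone_0_pi) auto
  then have cos: "cos ?\<alpha> \<noteq> 1" by simp
  note init = initial_symmetry[OF assms(1,2)]
  note sym = symmetry_persists[OF h init assms(3)]
  show "lam1 t = 0" "lam2 t = 0"
    using multipliers_vanish[OF h cos assms(3) sym] by auto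
qed

lemma curvature_bound_iff: "0 \<le> F t s \<longleftrightarrow> c0 \<le> \<kappa> t s" "F t s \<le> 0 \<longleftrightarrow> \<kappa> t s \<le> c0"
  using beta_pos[of "\<rho> t s"] by (auto simp: F_def zero_le_mult_iff mult_le_0_iff)

end

theorem theorem1p4:
  fixes L \<nu> \<mu> c0 :: real and k :: nat
    and \<beta> \<theta>\<^sub>0 \<rho>\<^sub>0 :: "real \<Rightarrow> real"
    and \<theta> \<rho> :: "real \<Rightarrow> real \<Rightarrow> real"
  assumes "L > 0" and "\<mu> > 0" and "smooth_on UNIV \<beta>" and "\<And>x. \<beta> x > 0"
    and "k \<ge> 2"
    and "admissible_datum L \<nu> 1 \<theta>\<^sub>0 \<rho>\<^sub>0"
    and "rot_symmetric L k \<theta>\<^sub>0 \<rho>\<^sub>0"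
    and "flow_solution L \<mu> 1 c0 \<beta> \<theta>\<^sub>0 \<rho>\<^sub>0 \<theta> \<rho>"
  shows "((\<forall>s\<in>{0..L}. deriv_within {0..L} \<theta>\<^sub>0 s \<ge> c0) \<longrightarrow> (\<forall>t\<ge>0. \<forall>s\<in>{0..L}. ps L \<theta> t s \<ge> c0)) \<and>
         ((\<forall>s\<in>{0..L}. deriv_within {0..L} \<theta>\<^sub>0 s \<le> c0) \<longrightarrow> (\<forall>t\<ge>0. \<forall>s\<in>{0..L}. ps L \<theta> t s \<le> c0))"
proof -
  interpret closed_flow L \<nu> \<mu> c0 \<beta> \<theta>\<^sub>0 \<rho>\<^sub>0 \<theta> \<rho>
    using assms by unfold_locales auto
  note lam = multipliers_zero_of_symmetric[OF assms(5,7)]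
  show ?thesis
    \<comment> \<open>The sign 1 gives the lower bound on the curvature and -1 the upper
      bound.\<close>
    using sign_F_persists[OF lam, of 1] sign_F_persists[OF lam, of "- 1"]
    by (simp add: curvature_bound_iff kappa_0)
qed

end
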